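(* Let $X$ be a uniformly regular compact subset of the complex plane and $(M_n)$ a nonanalytic weight sequence. If $T$ is a unital endomorphism of $D(X,M)$ which is a Riesz operator, induced by the selfmap $\phi$ of $X$ (i.e. $Tf=f\circ\phi$), and $x_0$ is the fixed point of $\phi$, then $$\sigma(T)=\{\phi'(x_0)^n: n \text{ a positive integer}\}\cup\{0,1\},$$ and each nonzero element of $\sigma(T)$ has multiplicity $1$.
   Context: $X\subset\mathbb C$ compact is uniformly regular if any two points $z,w\in X$ are joined by a rectifiable arc in $X$ and the geodesic metric on $X$ is uniformly equivalent to the Euclidean metric. $D^\infty(X)$ is the set of infinitely differentiable functions on $X$. A weight sequence $(M_n)$ consists of positive numbers with $M_0=1$ and $M_{n+m}/(M_nM_m)\ge\binom{n+m}{m}$; it is nonanalytic if $\lim_{n\to\infty}(n!/M_n)^{1/n}=0$. $D(X,M)=\{f\in D^\infty(X):\|f\|_D=\sum_{n\ge0}\|f^{(n)}\|_\infty/M_n<\infty\}$ with pointwise operations; in this setting it is a Banach algebra with maximal ideal space $X$ and unital endomorphisms are of the form $f\mapsto f\circ\phi$ for a continuous selfmap $\phi$ of $X$. $\sigma(T)$ denotes the spectrum of $T$. A bounded operator $T$ is a Riesz operator if $\lim_{n}\left[\inf\{\|T^n-K\|:K \text{ compact}\}\right]^{1/n}=0$; such a $\phi$ has a unique fixed point $x_0$. *)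

theory Defs
  imports "HOL-Analysis.Analysis"
begin

definition arc_length :: "(real \<Rightarrow> complex) \<Rightarrow> real" where
  "arc_length g = Sup {(\<Sum>i<k. cmod (g (t (Suc i)) - g (t i))) | k t.
      t 0 = 0 \<and> t k = 1 \<and> (\<forall>i<k. t i \<le> t (Suc i))}"

definition rectifiable :: "(real \<Rightarrow> complex) \<Rightarrow> bool" where
  "rectifiable g \<longleftrightarrow> bdd_above {(\<Sum>i<k. cmod (g (t (Suc i)) - g (t i))) | k t.
      t 0 = 0 \<and> t k = 1 \<and> (\<forall>i<k. t i \<le> t (Suc i))}"

definition rect_arc_in :: "complex set \<Rightarrow> complex \<Rightarrow> complex \<Rightarrow> (real \<Rightarrow> complex) \<Rightarrow> bool" where
  "rect_arc_in X z w g \<longleftrightarrow> arc g \<and> rectifiable g \<and> path_image g \<subseteq> X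
      \<and> pathstart g = z \<and> pathfinish g = w"

definition geodesic_dist :: "complex set \<Rightarrow> complex \<Rightarrow> complex \<Rightarrow> real" where
  "geodesic_dist X z w = (if z = w then 0 else Inf {arc_length g | g. rect_arc_in X z w g})"

definition uniformly_regular :: "complex set \<Rightarrow> bool" where
  "uniformly_regular X \<longleftrightarrow> compact X \<and> (\<exists>a b. a \<in> X \<and> b \<in> X \<and> a \<noteq> b)
     \<and> (\<forall>z\<in>X. \<forall>w\<in>X. z \<noteq> w \<longrightarrow> (\<exists>g. rect_arc_in X z w g))
     \<and> (\<exists>C. \<forall>z\<in>X. \<forall>w\<in>X. geodesic_dist X z w \<le> C * cmod (z - w))"

definition weight_seq :: "(nat \<Rightarrow> real) \<Rightarrow> bool" where
  "weight_seq M \<longleftrightarrow> (\<forall>n. M n > 0) \<and> M 0 = 1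
     \<and> (\<forall>n m. M (n + m) / (M n * M m) \<ge> real ((n + m) choose m))"

definition nonanalytic :: "(nat \<Rightarrow> real) \<Rightarrow> bool" where
  "nonanalytic M \<longleftrightarrow> (\<lambda>n. root n (fact n / M n)) \<longlonglongrightarrow> 0"

definition derivX :: "complex set \<Rightarrow> (complex \<Rightarrow> complex) \<Rightarrow> complex \<Rightarrow> complex" where
  "derivX X f z = (SOME D. (f has_field_derivative D) (at z within X))"

definition nderivX :: "complex set \<Rightarrow> nat \<Rightarrow> (complex \<Rightarrow> complex) \<Rightarrow> complex \<Rightarrow> complex" where
  "nderivX X n f = (derivX X ^^ n) f"

definition Dinf :: "complex set \<Rightarrow> (complex \<Rightarrow> complex) \<Rightarrow> bool" where
  "Dinf X f \<longleftrightarrow> (\<forall>n. \<forall>z\<in>X. (nderivX X n f has_field_derivative nderivX X (Suc n) f z) (at z within X))"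

definition supX :: "complex set \<Rightarrow> (complex \<Rightarrow> complex) \<Rightarrow> real" where
  "supX X f = Sup ((\<lambda>z. cmod (f z)) ` X)"

definition normD :: "complex set \<Rightarrow> (nat \<Rightarrow> real) \<Rightarrow> (complex \<Rightarrow> complex) \<Rightarrow> real" where
  "normD X M f = (\<Sum>n. supX X (nderivX X n f) / M n)"

text \<open>Elements of D(X,M), represented as functions vanishing off X.\<close>
definition Dspace :: "complex set \<Rightarrow> (nat \<Rightarrow> real) \<Rightarrow> (complex \<Rightarrow> complex) set" where
  "Dspace X M = {f. Dinf X f \<and> summable (\<lambda>n. supX X (nderivX X n f) / M n) \<and> (\<forall>z. z \<notin> X \<longrightarrow> f z = 0)}"

type_synonym opr = "(complex \<Rightarrow> complex) \<Rightarrow> (complex \<Rightarrow> complex)"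

definition lin_op :: "complex set \<Rightarrow> (nat \<Rightarrow> real) \<Rightarrow> opr \<Rightarrow> bool" where
  "lin_op X M A \<longleftrightarrow> (\<forall>f\<in>Dspace X M. A f \<in> Dspace X M)
     \<and> (\<forall>f\<in>Dspace X M. \<forall>g\<in>Dspace X M. A (\<lambda>z. f z + g z) = (\<lambda>z. A f z + A g z))
     \<and> (\<forall>f\<in>Dspace X M. \<forall>c. A (\<lambda>z. c * f z) = (\<lambda>z. c * A f z))"

definition bounded_op :: "complex set \<Rightarrow> (nat \<Rightarrow> real) \<Rightarrow> opr \<Rightarrow> bool" where
  "bounded_op X M A \<longleftrightarrow> lin_op X M A \<and> (\<exists>C. \<forall>f\<in>Dspace X M. normD X M (A f) \<le> C * normD X M f)"

definition op_norm :: "complex set \<Rightarrow> (nat \<Rightarrow> real) \<Rightarrow> opr \<Rightarrow> real" where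
  "op_norm X M A = Sup {normD X M (A f) | f. f \<in> Dspace X M \<and> normD X M f \<le> 1}"

definition compact_op :: "complex set \<Rightarrow> (nat \<Rightarrow> real) \<Rightarrow> opr \<Rightarrow> bool" where
  "compact_op X M K \<longleftrightarrow> lin_op X M K \<and>
     (\<forall>u::nat \<Rightarrow> complex \<Rightarrow> complex. (\<forall>n. u n \<in> Dspace X M \<and> normD X M (u n) \<le> 1) \<longrightarrow>
        (\<exists>r g. strict_mono r \<and> g \<in> Dspace X M \<and>
           (\<lambda>n. normD X M (\<lambda>z. K (u (r n)) z - g z)) \<longlonglongrightarrow> 0))"

definition ess_norm :: "complex set \<Rightarrow> (nat \<Rightarrow> real) \<Rightarrow> opr \<Rightarrow> real" where
  "ess_norm X M A = Inf {op_norm X M (\<lambda>f z. A f z - KK f z) | KK. compact_op X M KK}"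

definition riesz_op :: "complex set \<Rightarrow> (nat \<Rightarrow> real) \<Rightarrow> opr \<Rightarrow> bool" where
  "riesz_op X M T \<longleftrightarrow> bounded_op X M T \<and>
     (\<lambda>n. root n (ess_norm X M (T ^^ n))) \<longlonglongrightarrow> 0"

definition shift_op :: "opr \<Rightarrow> complex \<Rightarrow> opr" where
  "shift_op T lam = (\<lambda>f z. T f z - lam * f z)"

definition invertible_op :: "complex set \<Rightarrow> (nat \<Rightarrow> real) \<Rightarrow> opr \<Rightarrow> bool" where
  "invertible_op X M A \<longleftrightarrow> (\<exists>S. bounded_op X M S \<and>
     (\<forall>f\<in>Dspace X M. S (A f) = f) \<and> (\<forall>f\<in>Dspace X M. A (S f) = f))"

definition spectrum_op :: "complex set \<Rightarrow> (nat \<Rightarrow> real) \<Rightarrow> opr \<Rightarrow> complex set" where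
  "spectrum_op X M T = {lam. \<not> invertible_op X M (shift_op T lam)}"

definition gen_eigenspace :: "complex set \<Rightarrow> (nat \<Rightarrow> real) \<Rightarrow> opr \<Rightarrow> complex \<Rightarrow> (complex \<Rightarrow> complex) set" where
  "gen_eigenspace X M T lam = {f \<in> Dspace X M. \<exists>k. (shift_op T lam ^^ k) f = (\<lambda>z. 0)}"

definition mult_one :: "complex set \<Rightarrow> (nat \<Rightarrow> real) \<Rightarrow> opr \<Rightarrow> complex \<Rightarrow> bool" where
  "mult_one X M T lam \<longleftrightarrow> (\<exists>g\<in>gen_eigenspace X M T lam. g \<noteq> (\<lambda>z. 0) \<and>
     (\<forall>f\<in>gen_eigenspace X M T lam. \<exists>c. f = (\<lambda>z. c * g z)))"

definition comp_op :: "complex set \<Rightarrow> (complex \<Rightarrow> complex) \<Rightarrow> opr" where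
  "comp_op X \<phi> = (\<lambda>f z. if z \<in> X then f (\<phi> z) else 0)"

end

theory Submission
  imports Defs "HOL-Library.Function_Algebras" "HOL-Library.Diagonal_Subsequence"
begin

text \<open>
  Write \<open>\<lambda> = \<phi>'(x\<^sub>0)\<close> and let \<open>V\<^sub>k\<close> be the functions in \<open>D(X,M)\<close> that are \<open>O(|z - x\<^sub>0|\<^sup>k)\<close>, equivalently
  (Taylor, with mean value estimates along short arcs) those whose first \<open>k\<close> derivatives, starting
  with the zeroth, vanish at \<open>x\<^sub>0\<close>.  Then \<open>T\<close> is triangular with respect to the filtration \<open>V\<^sub>k\<close> and
  acts as \<open>\<lambda>\<^sup>k\<close> on the line \<open>V\<^sub>k / V\<^sub>k\<^sub>+\<^sub>1\<close>.  Hence \<open>(z - x\<^sub>0)\<^sup>n\<close>, for the least \<open>n\<close> giving the value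
  \<open>\<lambda>\<^sup>n\<close>, is not in the range of \<open>T - \<lambda>\<^sup>n\<close>, and a generalised eigenfunction for \<open>\<mu> \<noteq> 0\<close> is determined
  by one Taylor coefficient up to a function that is flat at \<open>x\<^sub>0\<close>.

  Being Riesz enters through Riesz's lemma.  It forces \<open>|\<lambda>| < 1\<close> (otherwise \<open>T\<close> would not shrink the
  infinite chain \<open>V\<^sub>k\<close>), it makes \<open>T - \<mu>\<close> invertible as soon as it is injective (\<open>\<mu> \<noteq> 0\<close>), and it
  bounds the orbit of the coordinate function, because \<open>T\<close> contracts the sup norm.  So the iterates of
  \<open>\<phi>\<close> are equi-Lipschitz; the basin of the attracting point \<open>x\<^sub>0\<close> is then open and closed in the
  connected set \<open>X\<close>, and every orbit converges to \<open>x\<^sub>0\<close> geometrically.  A flat eigenfunction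
  \<open>f \<circ> \<phi> = \<mu> f\<close> with \<open>\<mu> \<noteq> 0\<close> must therefore vanish.
\<close>

section \<open>Operators of vanishing essential spectral radius\<close>

lemma tendsto_0D:
  fixes f :: "nat \<Rightarrow> real"
  assumes "f \<longlonglongrightarrow> 0" "e > 0"
  shows "\<exists>k. \<forall>n\<ge>k. f n < e"
  using order_tendstoD(2)[OF assms] by (simp add: eventually_sequentially)

text \<open>The Banach space is a subset \<open>V\<close> of an ambient vector space: D(X,M) sits
  inside the type of all functions, and operators are total functions on that type which matter only
  on \<open>V\<close>.\<close>

locale banach_on = vector_space scale
  for scale :: "complex \<Rightarrow> 'v::ab_group_add \<Rightarrow> 'v" (infixr "\<odot>" 75) +
  fixes V :: "'v set" and N :: "'v \<Rightarrow> real"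
  assumes subspace_V: "subspace V"
    and N_nonneg: "x \<in> V \<Longrightarrow> 0 \<le> N x"
    and N_eq_0: "x \<in> V \<Longrightarrow> N x = 0 \<Longrightarrow> x = 0"
    and N_triangle: "x \<in> V \<Longrightarrow> y \<in> V \<Longrightarrow> N (x + y) \<le> N x + N y"
    and N_scale: "x \<in> V \<Longrightarrow> N (c \<odot> x) = cmod c * N x"
    and complete: "(\<And>n. f n \<in> V) \<Longrightarrow> (\<And>e. e > 0 \<Longrightarrow> \<exists>k. \<forall>m\<ge>k. \<forall>n\<ge>k. N (f m - f n) < e)
      \<Longrightarrow> \<exists>l\<in>V. (\<lambda>n. N (f n - l)) \<longlonglongrightarrow> 0"
begin

lemma V_add [simp]: "x \<in> V \<Longrightarrow> y \<in> V \<Longrightarrow> x + y \<in> V"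
  and V_diff [simp]: "x \<in> V \<Longrightarrow> y \<in> V \<Longrightarrow> x - y \<in> V"
  and V_scale [simp]: "x \<in> V \<Longrightarrow> c \<odot> x \<in> V"
  and V_0 [simp]: "0 \<in> V"
  using subspace_V by (auto intro: subspace_add subspace_diff subspace_scale subspace_0)

lemma N_0 [simp]: "N 0 = 0"
  using N_scale[of 0 0] by simp

lemma N_minus: "x \<in> V \<Longrightarrow> N (- x) = N x"
  using N_scale[of x "-1"] by simp

lemma N_commute: "x \<in> V \<Longrightarrow> y \<in> V \<Longrightarrow> N (x - y) = N (y - x)"
  using N_minus[of "x - y"] by simp

lemma N_triangle_diff: "x \<in> V \<Longrightarrow> y \<in> V \<Longrightarrow> z \<in> V \<Longrightarrow> N (x - z) \<le> N (x - y) + N (y - z)"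
  using N_triangle[of "x - y" "y - z"] by simp

lemma N_diff_le: "x \<in> V \<Longrightarrow> y \<in> V \<Longrightarrow> N (x - y) \<le> N x + N y"
  using N_triangle_diff[of x 0 y] N_minus by simp

definition lin_on :: "('v \<Rightarrow> 'v) \<Rightarrow> bool" where
  "lin_on A \<longleftrightarrow> (\<forall>x\<in>V. A x \<in> V) \<and> (\<forall>x\<in>V. \<forall>y\<in>V. A (x + y) = A x + A y)
    \<and> (\<forall>x\<in>V. \<forall>c. A (c \<odot> x) = c \<odot> A x)"

definition bounded_on :: "('v \<Rightarrow> 'v) \<Rightarrow> bool" where
  "bounded_on A \<longleftrightarrow> lin_on A \<and> (\<exists>C. \<forall>x\<in>V. N (A x) \<le> C * N x)"

definition compact_on :: "('v \<Rightarrow> 'v) \<Rightarrow> bool" where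
  "compact_on K \<longleftrightarrow> lin_on K \<and> (\<forall>u::nat \<Rightarrow> 'v. (\<forall>n. u n \<in> V \<and> N (u n) \<le> 1) \<longrightarrow>
     (\<exists>r g. strict_mono r \<and> g \<in> V \<and> (\<lambda>n. N (K (u (r n)) - g)) \<longlonglongrightarrow> 0))"

text \<open>Closedness is phrased with sequences and \<open>N\<close>, since the type
  \<open>'v\<close> carries no topology here; limits are sought inside \<open>V\<close>.\<close>

definition closed_sub :: "'v set \<Rightarrow> bool" where
  "closed_sub W \<longleftrightarrow> subspace W \<and> W \<subseteq> V \<and>
     (\<forall>x l. (\<forall>n. x n \<in> W) \<longrightarrow> l \<in> V \<longrightarrow> (\<lambda>n::nat. N (x n - l)) \<longlonglongrightarrow> 0 \<longrightarrow> l \<in> W)"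

text \<open>The margin \<open>1/8\<close> absorbs the factor \<open>1/2\<close> of Riesz's lemma and the triangle inequalities below.\<close>

definition near_compact :: "('v \<Rightarrow> 'v) \<Rightarrow> real \<Rightarrow> bool" where
  "near_compact T c \<longleftrightarrow> (\<exists>n\<ge>1. \<exists>K. compact_on K \<and> (\<forall>x\<in>V. N ((T ^^ n) x - K x) \<le> c ^ n / 8 * N x))"

lemma
  assumes "lin_on A"
  shows lin_on_V: "x \<in> V \<Longrightarrow> A x \<in> V"
    and lin_on_add: "x \<in> V \<Longrightarrow> y \<in> V \<Longrightarrow> A (x + y) = A x + A y"
    and lin_on_scale: "x \<in> V \<Longrightarrow> A (c \<odot> x) = c \<odot> A x"
  using assms unfolding lin_on_def by auto

lemma lin_on_0: "lin_on A \<Longrightarrow> A 0 = 0"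
  using lin_on_scale[of A 0 0] by simp

lemma lin_on_diff:
  assumes "lin_on A" "x \<in> V" "y \<in> V"
  shows "A (x - y) = A x - A y"
proof -
  have "A (x + (-1) \<odot> y) = A x + (-1) \<odot> A y"
    using assms by (metis lin_on_add lin_on_scale V_scale)
  then show ?thesis by simp
qed

lemma lin_on_pow:
  assumes "lin_on A"
  shows "lin_on (A ^^ n)"
proof (induction n)
  case 0
  show ?case by (simp add: lin_on_def)
next
  case (Suc n)
  then show ?case using assms by (auto simp: lin_on_def)
qed

lemma lin_on_shift: "lin_on T \<Longrightarrow> lin_on (\<lambda>x. T x - \<mu> \<odot> x)"
  unfolding lin_on_def by (auto simp: algebra_simps scale_right_diff_distrib scale_left_commute)

lemma bounded_onE:
  assumes "bounded_on A"
  obtains C where "C > 0" "\<And>x. x \<in> V \<Longrightarrow> N (A x) \<le> C * N x"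
proof -
  obtain C where C: "\<And>x. x \<in> V \<Longrightarrow> N (A x) \<le> C * N x"
    using assms by (auto simp: bounded_on_def)
  have "N (A x) \<le> (\<bar>C\<bar> + 1) * N x" if "x \<in> V" for x
    using C[OF that] mult_right_mono[of C "\<bar>C\<bar> + 1" "N x"] N_nonneg[OF that] by linarith
  then show ?thesis using that[of "\<bar>C\<bar> + 1"] by auto
qed

lemma bounded_on_pow:
  assumes "bounded_on A"
  shows "bounded_on (A ^^ n)"
proof -
  obtain C where C: "C > 0" "\<And>x. x \<in> V \<Longrightarrow> N (A x) \<le> C * N x"
    using bounded_onE[OF assms] by blast
  have lin: "lin_on (A ^^ m)" for m
    using assms lin_on_pow by (auto simp: bounded_on_def)
  have "N ((A ^^ n) x) \<le> C ^ n * N x" if "x \<in> V" for x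
  proof (induction n)
    case (Suc n)
    have "N ((A ^^ Suc n) x) \<le> C * N ((A ^^ n) x)"
      using C(2)[of "(A ^^ n) x"] lin_on_V[OF lin that] by simp
    also have "\<dots> \<le> C * (C ^ n * N x)"
      using Suc C(1) by simp
    finally show ?case by simp
  qed simp
  then show ?thesis using lin unfolding bounded_on_def by blast
qed

lemma bounded_on_shift:
  assumes "bounded_on T"
  shows "bounded_on (\<lambda>x. T x - \<mu> \<odot> x)"
proof -
  obtain C where C: "C > 0" "\<And>x. x \<in> V \<Longrightarrow> N (T x) \<le> C * N x"
    using bounded_onE[OF assms] by blast
  have lin: "lin_on T" using assms by (simp add: bounded_on_def)
  have "N (T x - \<mu> \<odot> x) \<le> (C + cmod \<mu>) * N x" if "x \<in> V" for x
    using N_diff_le[of "T x" "\<mu> \<odot> x"] C(2)[OF that] that lin_on_V[OF lin that] N_scale[OF that, of \<mu>]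
    by (simp add: algebra_simps)
  then show ?thesis using lin_on_shift[OF lin] unfolding bounded_on_def by blast
qed

text \<open>Vectors \<open>u n\<close> of the unit ball with \<open>N (K (u n)) > n\<close> would
  have no subsequence with convergent images; homogeneity extends the bound from the unit ball to
  \<open>V\<close>.\<close>

lemma compact_on_bounded:
  assumes "compact_on K"
  shows "bounded_on K"
proof -
  have lin: "lin_on K" using assms by (simp add: compact_on_def)
  have "\<exists>C. \<forall>x\<in>V. N x \<le> 1 \<longrightarrow> N (K x) \<le> C"
  proof (rule ccontr)
    assume "\<not> ?thesis"
    then have "\<forall>n::nat. \<exists>x\<in>V. N x \<le> 1 \<and> N (K x) > real n"
      by (meson not_le)
    then obtain u where u: "\<And>n. u n \<in> V" "\<And>n. N (u n) \<le> 1" "\<And>n. N (K (u n)) > real n"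
      by metis
    then obtain r g where r: "strict_mono r" "g \<in> V" "(\<lambda>n. N (K (u (r n)) - g)) \<longlonglongrightarrow> 0"
      using assms unfolding compact_on_def by blast
    then obtain n0 where n0: "\<And>n. n \<ge> n0 \<Longrightarrow> N (K (u (r n)) - g) < 1"
      using tendsto_0D[OF r(3) zero_less_one] by blast
    obtain n1 :: nat where n1: "real n1 > 1 + N g" using reals_Archimedean2 by blast
    define n where "n = max n0 n1"
    have "N (K (u (r n))) \<le> N (K (u (r n)) - g) + N g"
      using N_triangle[of "K (u (r n)) - g" g] r(2) lin_on_V[OF lin u(1)] by simp
    moreover have "N (K (u (r n)) - g) < 1" using n0 by (simp add: n_def)
    moreover have "real n1 \<le> real (r n)"
      using seq_suble[OF r(1), of n] by (simp add: n_def)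
    ultimately show False using u(3)[of "r n"] n1 by linarith
  qed
  then obtain C where C: "\<And>x. x \<in> V \<Longrightarrow> N x \<le> 1 \<Longrightarrow> N (K x) \<le> C" by blast
  have "N (K x) \<le> C * N x" if x: "x \<in> V" for x
  proof (cases "x = 0")
    case True
    then show ?thesis by (simp add: lin_on_0[OF lin])
  next
    case False
    then have pos: "N x > 0" using N_eq_0 N_nonneg x by fastforce
    have "N (K (complex_of_real (1 / N x) \<odot> x)) \<le> C"
      by (rule C) (use x pos in \<open>auto simp: N_scale norm_divide\<close>)
    then have "N (K x) / N x \<le> C"
      using x pos by (simp add: lin_on_scale[OF lin] N_scale lin_on_V[OF lin] norm_divide)
    then show ?thesis using pos by (simp add: field_simps)
  qed
  then show ?thesis using lin unfolding bounded_on_def by blast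
qed

section \<open>Riesz's lemma and separated sequences\<close>

text \<open>A point \<open>y\<close> off the closed \<open>W\<close> has positive distance
  \<open>d\<close> from it. Take \<open>w0\<close> in \<open>W\<close> closer to \<open>y\<close>
  than \<open>2 * d\<close> and normalise \<open>y - w0\<close>; the constant 1/2 is the ratio of
  \<open>d\<close> to \<open>2 * d\<close>.\<close>

lemma riesz_lemma:
  assumes W: "closed_sub W" and U: "subspace U" "U \<subseteq> V" "W \<subseteq> U" and y: "y \<in> U" "y \<notin> W"
  shows "\<exists>v\<in>U. N v = 1 \<and> (\<forall>w\<in>W. N (v - w) \<ge> 1/2)"
proof -
  define d where "d = Inf ((\<lambda>w. N (y - w)) ` W)"
  have sub: "subspace W" and WV: "W \<subseteq> V" using W by (auto simp: closed_sub_def)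
  have yV: "y \<in> V" using y U by auto
  have W0: "0 \<in> W" using subspace_0[OF sub] .
  have bdd: "bdd_below ((\<lambda>w. N (y - w)) ` W)"
    by (rule bdd_belowI[of _ 0]) (use yV WV in \<open>auto intro!: N_nonneg\<close>)
  have d_le: "d \<le> N (y - w)" if "w \<in> W" for w
    unfolding d_def by (rule cInf_lower) (use that bdd in auto)
  have approx: "\<exists>w\<in>W. N (y - w) < e" if "d < e" for e
    using cInf_lessD[of "(\<lambda>w. N (y - w)) ` W" e] that W0 by (auto simp: d_def)
  have "d > 0"
  proof (rule ccontr)
    assume "\<not> d > 0"
    then have "\<forall>n. \<exists>w\<in>W. N (y - w) < inverse (real (Suc n))"
      by (intro allI approx) (smt (verit) inverse_positive_iff_positive of_nat_0_less_iff zero_less_Suc)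
    then obtain w where w: "\<And>n. w n \<in> W" "\<And>n. N (y - w n) < inverse (real (Suc n))"
      by metis
    have "(\<lambda>n. N (w n - y)) \<longlonglongrightarrow> 0"
    proof (rule real_tendsto_sandwich[OF _ _ tendsto_const LIMSEQ_inverse_real_of_nat])
      show "\<forall>\<^sub>F n in sequentially. 0 \<le> N (w n - y)"
        using w WV yV by (intro always_eventually allI N_nonneg V_diff) auto
      show "\<forall>\<^sub>F n in sequentially. N (w n - y) \<le> inverse (real (Suc n))"
        using w WV yV by (intro always_eventually allI) (metis N_commute less_imp_le subsetD)
    qed
    then have "y \<in> W" using W w(1) yV unfolding closed_sub_def by blast
    then show False using y by simp
  qed
  then obtain w0 where w0: "w0 \<in> W" "N (y - w0) < 2 * d"
    using approx[of "2 * d"] by auto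
  define t where "t = N (y - w0)"
  have t: "t > 0" "t < 2 * d" using d_le[OF w0(1)] \<open>d > 0\<close> w0 by (auto simp: t_def)
  define v where "v = complex_of_real (1 / t) \<odot> (y - w0)"
  have yw: "y - w0 \<in> V" using yV w0 WV by auto
  have "v \<in> U" unfolding v_def
    using U y w0 by (auto intro!: subspace_scale subspace_diff)
  moreover have "N v = 1"
    using t yw by (simp add: v_def N_scale norm_divide flip: t_def)
  moreover have "N (v - w) \<ge> 1/2" if w: "w \<in> W" for w
  proof -
    \<comment> \<open>Scaling by \<open>t\<close> turns the distance from \<open>v\<close> to
      \<open>w\<close> into the distance from \<open>y\<close> to this point of \<open>W\<close>,
      which is at least \<open>d\<close>.\<close>
    have "w0 + complex_of_real t \<odot> w \<in> W"
      using w w0 sub by (auto intro!: subspace_add subspace_scale)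
    then have "d \<le> N (y - (w0 + complex_of_real t \<odot> w))" by (rule d_le)
    also have "y - (w0 + complex_of_real t \<odot> w) = complex_of_real t \<odot> (v - w)"
      using t by (simp add: v_def scale_right_diff_distrib)
    also have "N \<dots> = t * N (v - w)"
    proof -
      have "v - w \<in> V" using \<open>v \<in> U\<close> U w WV by (intro V_diff) auto
      then show ?thesis using N_scale t by simp
    qed
    finally have "d \<le> t * N (v - w)" .
    then have "t * (1/2) \<le> t * N (v - w)" using t by linarith
    then show ?thesis using t(1) mult_le_cancel_left_pos by blast
  qed
  ultimately show ?thesis by blast
qed

text \<open>Dropping an initial segment of a convergent subsequence of images puts all remaining
  images within \<open>e / 2\<close> of the limit, hence within \<open>e\<close> of each
  other.\<close>

lemma compact_on_close:
  assumes "compact_on K" "\<And>k. y k \<in> V" "\<And>k. N (y k) \<le> 1" "e > 0"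
  shows "\<exists>r::nat \<Rightarrow> nat. strict_mono r \<and> (\<forall>i j. N (K (y (r i)) - K (y (r j))) < e)"
proof -
  have lin: "lin_on K" using assms by (simp add: compact_on_def)
  obtain r g where r: "strict_mono r" "g \<in> V" "(\<lambda>n. N (K (y (r n)) - g)) \<longlonglongrightarrow> 0"
    using assms unfolding compact_on_def by blast
  then obtain n0 where n0: "\<And>n. n \<ge> n0 \<Longrightarrow> N (K (y (r n)) - g) < e / 2"
    using tendsto_0D[OF r(3), of "e / 2"] assms(4) by auto
  show ?thesis
  proof (intro exI[of _ "\<lambda>i. r (i + n0)"] conjI allI)
    show "strict_mono (\<lambda>i. r (i + n0))" using r(1) by (auto simp: strict_mono_def)
    fix i j
    have V: "K (y k) \<in> V" for k using lin_on_V[OF lin] assms(2) by blast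
    have "N (K (y (r (i + n0))) - K (y (r (j + n0))))
        \<le> N (K (y (r (i + n0))) - g) + N (g - K (y (r (j + n0))))"
      using N_triangle_diff V r(2) by blast
    also have "\<dots> < e / 2 + e / 2"
      using n0[of "i + n0"] n0[of "j + n0"] N_commute[OF r(2) V] by simp
    finally show "N (K (y (r (i + n0))) - K (y (r (j + n0)))) < e" by simp
  qed
qed

text \<open>For the exponent \<open>n\<close> supplied by \<open>near_compact\<close>, two of the
  compact images are within \<open>c ^ n / 8\<close>, and replacing each by its image under
  \<open>T ^^ n\<close> costs \<open>c ^ n / 8\<close> more. The total \<open>3/8 * c ^ n\<close> is
  below the separation. As \<open>n\<close> is not known beforehand, the separation is assumed for
  all exponents.\<close>

lemma no_separated_images:
  assumes "lin_on T" "near_compact T c" "c > 0"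
    and y: "\<And>k::nat. y k \<in> V" "\<And>k. N (y k) \<le> 1"
    and sep: "\<And>n k l. k < l \<Longrightarrow> N ((T ^^ n) (y k) - (T ^^ n) (y l)) \<ge> c ^ n / 2"
  shows False
proof -
  obtain n K where K: "compact_on K" "\<And>x. x \<in> V \<Longrightarrow> N ((T ^^ n) x - K x) \<le> c ^ n / 8 * N x"
    using assms(2) unfolding near_compact_def by blast
  have lin: "lin_on K" "lin_on (T ^^ n)" using assms K lin_on_pow by (auto simp: compact_on_def)
  note V = y lin_on_V[OF lin(1)] lin_on_V[OF lin(2)]
  obtain r :: "nat \<Rightarrow> nat" where r: "strict_mono r" "\<And>i j. N (K (y (r i)) - K (y (r j))) < c ^ n / 8"
  proof -
    have "c ^ n / 8 > 0" using assms(3) by simp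
    from compact_on_close[of K y "c ^ n / 8", OF K(1) y this] that show ?thesis by blast
  qed
  define a b where "a = y (r 0)" and "b = y (r 1)"
  have small: "N ((T ^^ n) (y k) - K (y k)) \<le> c ^ n / 8" for k
  proof -
    have "c ^ n / 8 * N (y k) \<le> c ^ n / 8 * 1"
      using y(2)[of k] assms(3) by (intro mult_left_mono) auto
    then show ?thesis using K(2)[OF y(1)[of k]] by simp
  qed
  have "c ^ n / 2 \<le> N ((T ^^ n) a - (T ^^ n) b)"
    unfolding a_def b_def by (rule sep) (use r(1) in \<open>simp add: strict_mono_less\<close>)
  also have "\<dots> \<le> N ((T ^^ n) a - K a) + N (K a - (T ^^ n) b)"
    unfolding a_def b_def by (rule N_triangle_diff) (auto intro: V)
  also have "N (K a - (T ^^ n) b) \<le> N (K a - K b) + N (K b - (T ^^ n) b)"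
    unfolding a_def b_def by (rule N_triangle_diff) (auto intro: V)
  also have "N (K b - (T ^^ n) b) = N ((T ^^ n) b - K b)"
    unfolding a_def b_def by (rule N_commute) (auto intro: V)
  finally show False
    using small[of "r 0"] small[of "r 1"] r(2)[of 0 1] zero_less_power[OF assms(3), of n]
    unfolding a_def b_def by linarith
qed

lemma riesz_sequence:
  assumes "\<And>k. closed_sub (U k)" "\<And>k. U (Suc k) \<subset> U k"
  obtains y where "\<And>k. y k \<in> U k" "\<And>k. N (y k) = 1" "\<And>k w. w \<in> U (Suc k) \<Longrightarrow> N (y k - w) \<ge> 1/2"
proof -
  have "\<exists>v\<in>U k. N v = 1 \<and> (\<forall>w\<in>U (Suc k). N (v - w) \<ge> 1/2)" for k
  proof -
    obtain y where "y \<in> U k" "y \<notin> U (Suc k)" using assms(2)[of k] by blast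
    then show ?thesis
      using riesz_lemma[OF assms(1)[of "Suc k"], of "U k" y] assms(1)[of k] assms(2)[of k]
      by (auto simp: closed_sub_def)
  qed
  then show ?thesis using that by metis
qed

lemma decreasing_closed_sub:
  assumes "\<And>k. U (Suc k) \<subset> U k" "k < l"
  shows "U l \<subseteq> U (Suc k)"
  using lift_Suc_antimono_le[of U "Suc k" l] assms by (meson Suc_leI psubset_imp_subset)

text \<open>Pick a Riesz sequence \<open>y k\<close> along the chain. Modulo
  \<open>U (Suc k)\<close>, \<open>T ^^ n\<close> multiplies \<open>y k\<close> by
  \<open>a k ^ n\<close> and sends \<open>y l\<close> to 0 for \<open>l > k\<close>, so the images
  under \<open>T ^^ n\<close> stay separated by \<open>c ^ n / 2\<close>.\<close>

lemma no_expanding_chain: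
  assumes T: "lin_on T" "near_compact T c" "c > 0"
    and U: "\<And>k. closed_sub (U k)" "\<And>k. U (Suc k) \<subset> U k"
    and inv: "\<And>k x. x \<in> U k \<Longrightarrow> T x \<in> U k"
    and diag: "\<And>k x. x \<in> U k \<Longrightarrow> T x - a k \<odot> x \<in> U (Suc k)" "\<And>k. cmod (a k) \<ge> c"
  shows False
proof -
  obtain y where y: "\<And>k. y k \<in> U k" "\<And>k. N (y k) = 1" "\<And>k w. w \<in> U (Suc k) \<Longrightarrow> N (y k - w) \<ge> 1/2"
    using riesz_sequence[of U] U by blast
  have sub: "subspace (U k)" and UV: "U k \<subseteq> V" for k using U(1)[of k] by (auto simp: closed_sub_def)
  have inv_n: "(T ^^ n) x \<in> U k" if "x \<in> U k" for n k x
    using that by (induction n) (auto intro: inv)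
  have diag_n: "(T ^^ n) x - a k ^ n \<odot> x \<in> U (Suc k)" if x: "x \<in> U k" for n k x
  proof (induction n)
    case 0
    then show ?case using subspace_0[OF sub] by simp
  next
    case (Suc n)
    have xV: "x \<in> V" "(T ^^ n) x \<in> V" using x UV inv_n[OF x] by auto
    have "T ((T ^^ n) x - a k ^ n \<odot> x) + a k ^ n \<odot> (T x - a k \<odot> x) \<in> U (Suc k)"
      by (intro subspace_add[OF sub] subspace_scale[OF sub] inv Suc diag x)
    also have "T ((T ^^ n) x - a k ^ n \<odot> x) + a k ^ n \<odot> (T x - a k \<odot> x)
        = (T ^^ Suc n) x - a k ^ Suc n \<odot> x"
      using xV T(1) by (simp add: lin_on_diff lin_on_scale scale_right_diff_distrib mult.commute)
    finally show ?case .
  qed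
  have "N ((T ^^ n) (y k) - (T ^^ n) (y l)) \<ge> c ^ n / 2" if kl: "k < l" for n k l
  proof -
    define b where "b = a k ^ n"
    have b: "cmod b \<ge> c ^ n" unfolding b_def norm_power using diag(2)[of k] T(3) by (intro power_mono) auto
    then have b0: "b \<noteq> 0" "cmod b > 0" using zero_less_power[OF T(3), of n] by auto
    \<comment> \<open>Everything lying in \<open>U (Suc k)\<close> is collected here, so that the
      difference of the two images is \<open>b \<odot> y k - w\<close>.\<close>
    define w where "w = (T ^^ n) (y l) - ((T ^^ n) (y k) - b \<odot> y k)"
    have "(T ^^ n) (y l) \<in> U (Suc k)"
      using decreasing_closed_sub[of U, OF U(2) kl] inv_n[OF y(1)] by blast
    then have w: "w \<in> U (Suc k)"
      unfolding w_def b_def by (intro subspace_diff[OF sub] diag_n y)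
    then have w': "inverse b \<odot> w \<in> U (Suc k)" using subspace_scale[OF sub] by blast
    have "1/2 \<le> N (y k - inverse b \<odot> w)" by (rule y(3)[OF w'])
    then have "cmod b * (1/2) \<le> cmod b * N (y k - inverse b \<odot> w)"
      using b0 by simp
    also have "\<dots> = N (b \<odot> (y k - inverse b \<odot> w))"
      using w' y(1)[of k] UV by (subst N_scale) (auto intro!: V_diff)
    also have "b \<odot> (y k - inverse b \<odot> w) = (T ^^ n) (y k) - (T ^^ n) (y l)"
      using b0 by (simp add: scale_right_diff_distrib w_def)
    finally show ?thesis using b by linarith
  qed
  moreover have "y k \<in> V" "N (y k) \<le> 1" for k using y(1,2)[of k] UV[of k] by auto
  ultimately show False using no_separated_images[OF T] by blast
qed

section \<open>Invertibility of injective shifts \<open>T - \<mu>\<close>\<close>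

text \<open>The lower bound makes preimages of a convergent sequence Cauchy. Their limit lies in
  \<open>W\<close> by closedness, and continuity of \<open>A\<close> identifies its image.\<close>

lemma closed_sub_image:
  assumes A: "bounded_on A" and c: "c > 0" "\<And>x. x \<in> V \<Longrightarrow> N (A x) \<ge> c * N x"
    and W: "closed_sub W"
  shows "closed_sub (A ` W)"
proof -
  obtain C where C: "C > 0" "\<And>x. x \<in> V \<Longrightarrow> N (A x) \<le> C * N x"
    using bounded_onE[OF A] by blast
  have lin: "lin_on A" using A by (simp add: bounded_on_def)
  have sub: "subspace W" and WV: "W \<subseteq> V" using W by (auto simp: closed_sub_def)
  have "subspace (A ` W)"
  proof (rule subspaceI)
    show "0 \<in> A ` W" using lin_on_0[OF lin] subspace_0[OF sub] by force
    show "x + y \<in> A ` W" if "x \<in> A ` W" "y \<in> A ` W" for x y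
    proof -
      obtain u v where "u \<in> W" "v \<in> W" "x = A u" "y = A v" using \<open>x \<in> A ` W\<close> \<open>y \<in> A ` W\<close> by blast
      then show ?thesis using subspace_add[OF sub] lin_on_add[OF lin] WV by (metis image_eqI subsetD)
    qed
    show "k \<odot> x \<in> A ` W" if "x \<in> A ` W" for x k
    proof -
      obtain u where "u \<in> W" "x = A u" using \<open>x \<in> A ` W\<close> by blast
      then show ?thesis using subspace_scale[OF sub] lin_on_scale[OF lin] WV by (metis image_eqI subsetD)
    qed
  qed
  moreover have "A ` W \<subseteq> V" using WV lin_on_V[OF lin] by auto
  moreover have "l \<in> A ` W" if x: "\<And>n. x n \<in> A ` W" and l: "l \<in> V" "(\<lambda>n::nat. N (x n - l)) \<longlonglongrightarrow> 0" for x l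
  proof -
    have "\<forall>n. \<exists>w\<in>W. x n = A w" using x by blast
    then obtain w where w: "\<And>n. w n \<in> W" "\<And>n. x n = A (w n)" by metis
    have wV: "w n \<in> V" "x n \<in> V" for n using w WV lin_on_V[OF lin] by auto
    have "\<exists>m\<in>V. (\<lambda>n. N (w n - m)) \<longlonglongrightarrow> 0"
    proof (rule complete[OF wV(1)])
      fix e :: real assume "e > 0"
      then have "c * e / 2 > 0" using c by simp
      then obtain k where k: "\<And>n. n \<ge> k \<Longrightarrow> N (x n - l) < c * e / 2"
        using tendsto_0D[OF l(2)] by blast
      have "N (w m - w n) < e" if "m \<ge> k" "n \<ge> k" for m n
      proof -
        have "c * N (w m - w n) \<le> N (A (w m - w n))" using c(2) wV by simp
        also have "\<dots> = N (x m - x n)" using lin_on_diff[OF lin] wV w by simp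
        also have "\<dots> \<le> N (x m - l) + N (l - x n)" using N_triangle_diff wV l by blast
        also have "\<dots> < c * e" using k[OF that(1)] k[OF that(2)] N_commute[OF l(1) wV(2)] by simp
        finally show ?thesis using c(1) by simp
      qed
      then show "\<exists>k. \<forall>m\<ge>k. \<forall>n\<ge>k. N (w m - w n) < e" by blast
    qed
    then obtain m where m: "m \<in> V" "(\<lambda>n. N (w n - m)) \<longlonglongrightarrow> 0" by blast
    then have mW: "m \<in> W" using W w(1) unfolding closed_sub_def by blast
    have "(\<lambda>n. C * N (w n - m) + N (x n - l)) \<longlonglongrightarrow> C * 0 + 0"
      by (intro tendsto_intros m l)
    moreover have "N (A m - l) \<le> C * N (w n - m) + N (x n - l)" for n
    proof -
      have "N (A m - l) \<le> N (A m - x n) + N (x n - l)"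
        using N_triangle_diff wV l lin_on_V[OF lin m(1)] by blast
      also have "N (A m - x n) = N (A (w n - m))"
        using lin_on_diff[OF lin] w wV m lin_on_V[OF lin] N_commute by simp
      also have "\<dots> \<le> C * N (w n - m)" using C wV m by simp
      finally show ?thesis by simp
    qed
    ultimately have "N (A m - l) \<le> 0"
      by (intro LIMSEQ_le_const[of _ 0]) auto
    then have "A m = l"
      using N_eq_0[of "A m - l"] N_nonneg[of "A m - l"] lin_on_V[OF lin m(1)] l by fastforce
    then show ?thesis using mW by blast
  qed
  ultimately show ?thesis unfolding closed_sub_def by blast
qed

text \<open>Otherwise there are unit vectors \<open>x k\<close> with \<open>A (x k)\<close> tending
  to 0. On them \<open>T ^^ n\<close> is nearly \<open>\<mu> ^ n\<close>, and it is also nearly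
  compact, so a subsequence is Cauchy. Its limit would be a unit vector in the kernel of
  \<open>A\<close>.\<close>

lemma shift_bounded_below:
  assumes T: "bounded_on T" "near_compact T (cmod \<mu>)" and mu: "\<mu> \<noteq> 0"
    and inj: "\<And>x. x \<in> V \<Longrightarrow> T x - \<mu> \<odot> x = 0 \<Longrightarrow> x = 0"
  shows "\<exists>c>0. \<forall>x\<in>V. N (T x - \<mu> \<odot> x) \<ge> c * N x"
proof (rule ccontr)
  assume neg: "\<not> ?thesis"
  define A where "A = (\<lambda>x. T x - \<mu> \<odot> x)"
  have bA: "bounded_on A" unfolding A_def by (rule bounded_on_shift[OF T(1)])
  obtain C where C: "C > 0" "\<And>x. x \<in> V \<Longrightarrow> N (A x) \<le> C * N x"
    using bounded_onE[OF bA] by blast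
  have lin: "lin_on A" "lin_on T" using bA T by (auto simp: bounded_on_def)
  obtain n K where K: "compact_on K" "\<And>x. x \<in> V \<Longrightarrow> N ((T ^^ n) x - K x) \<le> cmod \<mu> ^ n / 8 * N x"
    using T(2) unfolding near_compact_def by blast
  have linK: "lin_on K" "lin_on (T ^^ n)" using lin_on_pow K lin by (auto simp: compact_on_def)
  have "\<exists>x\<in>V. N x = 1 \<and> N (A x) < inverse (real (Suc k))" for k
  proof -
    have "\<not> (\<forall>x\<in>V. N (T x - \<mu> \<odot> x) \<ge> inverse (real (Suc k)) * N x)"
      using neg by (metis inverse_positive_iff_positive of_nat_0_less_iff zero_less_Suc)
    then obtain x where x: "x \<in> V" "N (A x) < inverse (real (Suc k)) * N x" by (auto simp: A_def not_le)
    then have pos: "N x > 0"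
      using N_nonneg[of "A x"] lin_on_V[OF lin(1) x(1)] N_nonneg[OF x(1)]
      by (metis mult_zero_right order_le_less not_less)
    define x' where "x' = complex_of_real (1 / N x) \<odot> x"
    have "N x' = 1" using pos x by (simp add: x'_def N_scale norm_divide)
    moreover have "N (A x') = N (A x) / N x"
      using pos x lin_on_V[OF lin(1)] by (simp add: x'_def N_scale lin_on_scale[OF lin(1)] norm_divide)
    moreover have "x' \<in> V" using x by (simp add: x'_def)
    ultimately show ?thesis using x(2) pos
      by (intro bexI[of _ x']) (auto simp: pos_divide_less_eq simp del: of_nat_Suc)
  qed
  then obtain x where x: "\<And>k. x k \<in> V" "\<And>k. N (x k) = 1" "\<And>k. N (A (x k)) < inverse (real (Suc k))"
    by metis
  have Ax0: "(\<lambda>k. N (A (x k))) \<longlonglongrightarrow> 0"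
  proof (rule real_tendsto_sandwich[OF _ _ tendsto_const LIMSEQ_inverse_real_of_nat])
    show "\<forall>\<^sub>F k in sequentially. 0 \<le> N (A (x k))"
      using x lin_on_V[OF lin(1)] by (auto intro!: always_eventually N_nonneg)
    show "\<forall>\<^sub>F k in sequentially. N (A (x k)) \<le> inverse (real (Suc k))"
      using x by (auto intro!: always_eventually less_imp_le)
  qed
  obtain D where D: "D > 0" "\<And>x. x \<in> V \<Longrightarrow> N (T x) \<le> D * N x"
    using bounded_onE[OF T(1)] by blast
  \<comment> \<open>The polynomial \<open>T ^^ n - \<mu> ^ n\<close> is divisible by
    \<open>T - \<mu>\<close>; the induction bounds the cofactor.\<close>
  have "\<exists>E\<ge>0. \<forall>x\<in>V. N ((T ^^ n) x - \<mu> ^ n \<odot> x) \<le> E * N (A x)"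
  proof (induction n)
    case 0
    show ?case by (auto intro!: exI[of _ 0])
  next
    case (Suc n)
    then obtain E where E: "E \<ge> 0" "\<And>x. x \<in> V \<Longrightarrow> N ((T ^^ n) x - \<mu> ^ n \<odot> x) \<le> E * N (A x)" by blast
    have "N ((T ^^ Suc n) x - \<mu> ^ Suc n \<odot> x) \<le> (D * E + cmod \<mu> ^ n) * N (A x)" if xV: "x \<in> V" for x
    proof -
      have TV: "(T ^^ n) x \<in> V" using lin_on_pow[OF lin(2)] lin_on_V xV by blast
      have "(T ^^ Suc n) x - \<mu> ^ Suc n \<odot> x = T ((T ^^ n) x - \<mu> ^ n \<odot> x) + \<mu> ^ n \<odot> A x"
        using xV TV lin by (simp add: A_def lin_on_diff lin_on_scale scale_right_diff_distrib mult.commute)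
      also have "N \<dots> \<le> N (T ((T ^^ n) x - \<mu> ^ n \<odot> x)) + N (\<mu> ^ n \<odot> A x)"
        using xV TV lin by (intro N_triangle V_scale lin_on_V[OF lin(2)] lin_on_V[OF lin(1)] V_diff)
      also have "N (T ((T ^^ n) x - \<mu> ^ n \<odot> x)) \<le> D * N ((T ^^ n) x - \<mu> ^ n \<odot> x)"
        using D xV TV by simp
      also have "\<dots> \<le> D * (E * N (A x))" using D E xV by simp
      also have "N (\<mu> ^ n \<odot> A x) = cmod \<mu> ^ n * N (A x)"
        using lin_on_V[OF lin(1) xV] by (simp add: N_scale norm_power)
      finally show ?thesis by (simp add: algebra_simps)
    qed
    moreover have "D * E + cmod \<mu> ^ n \<ge> 0" using D E by simp
    ultimately show ?case by blast
  qed
  then obtain E where E: "E \<ge> 0" "\<And>x. x \<in> V \<Longrightarrow> N ((T ^^ n) x - \<mu> ^ n \<odot> x) \<le> E * N (A x)" by blast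
  obtain r g where r: "strict_mono r" "g \<in> V" "(\<lambda>k. N (K (x (r k)) - g)) \<longlonglongrightarrow> 0"
  proof -
    have "\<forall>k. x k \<in> V \<and> N (x k) \<le> 1" using x(1,2) by simp
    then show ?thesis using K(1) that unfolding compact_on_def by blast
  qed
  have Axr: "(\<lambda>k. N (A (x (r k)))) \<longlonglongrightarrow> 0"
    using LIMSEQ_subseq_LIMSEQ[OF Ax0 r(1)] by (simp add: o_def)
  define p where "p = cmod \<mu> ^ n"
  have p: "p > 0" using mu by (simp add: p_def)
  define h where "h k = E * N (A (x (r k))) + N (K (x (r k)) - g)" for k
  have h0: "h \<longlonglongrightarrow> 0" unfolding h_def
    by (rule tendsto_eq_intros Axr r | simp)+
  \<comment> \<open>The compact approximation leaves an error \<open>p / 8 * N (a - b)\<close>,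
    which is absorbed into the left side; the remaining factor 8/7 is rounded up to 2.\<close>
  have est: "p * N (x (r i) - x (r j)) \<le> 2 * (h i + h j)" for i j
  proof -
    define a b where "a = x (r i)" and "b = x (r j)"
    have ab: "a \<in> V" "b \<in> V" using x by (auto simp: a_def b_def)
    note V = ab lin_on_V[OF linK(1)] lin_on_V[OF linK(2)] r(2)
    have "p * N (a - b) = N (\<mu> ^ n \<odot> (a - b))" using ab by (simp add: N_scale norm_power p_def)
    also have "\<mu> ^ n \<odot> (a - b) = ((T ^^ n) (a - b) - K (a - b)) + (K a - K b)
        + (((T ^^ n) b - \<mu> ^ n \<odot> b) - ((T ^^ n) a - \<mu> ^ n \<odot> a))"
      using ab linK by (simp add: lin_on_diff scale_right_diff_distrib)
    also have "N \<dots> \<le> N (((T ^^ n) (a - b) - K (a - b)) + (K a - K b))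
        + N (((T ^^ n) b - \<mu> ^ n \<odot> b) - ((T ^^ n) a - \<mu> ^ n \<odot> a))"
      by (rule N_triangle) (auto simp: V)
    also have "N (((T ^^ n) (a - b) - K (a - b)) + (K a - K b))
        \<le> N ((T ^^ n) (a - b) - K (a - b)) + N (K a - K b)"
      by (rule N_triangle) (auto simp: V)
    also have "N ((T ^^ n) (a - b) - K (a - b)) \<le> p / 8 * N (a - b)"
      unfolding p_def using K(2)[of "a - b"] ab by auto
    also have "N (K a - K b) \<le> N (K a - g) + N (g - K b)"
      by (rule N_triangle_diff) (auto simp: V)
    also have "N (g - K b) = N (K b - g)"
      by (rule N_commute) (auto simp: V)
    also have "N (((T ^^ n) b - \<mu> ^ n \<odot> b) - ((T ^^ n) a - \<mu> ^ n \<odot> a))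
        \<le> N ((T ^^ n) b - \<mu> ^ n \<odot> b) + N ((T ^^ n) a - \<mu> ^ n \<odot> a)"
      by (rule N_diff_le) (auto simp: V)
    also have "\<dots> \<le> E * N (A b) + E * N (A a)" using E(2)[OF ab(1)] E(2)[OF ab(2)] by simp
    finally have "p * N (a - b) \<le> p / 8 * N (a - b) + (h i + h j)"
      by (simp add: h_def a_def b_def)
    moreover have "p * N (a - b) \<ge> 0" using p ab by (simp add: N_nonneg)
    ultimately show ?thesis unfolding a_def b_def by simp
  qed
  have "\<exists>l\<in>V. (\<lambda>k. N (x (r k) - l)) \<longlonglongrightarrow> 0"
  proof (rule complete)
    fix e :: real assume "e > 0"
    define d where "d = p * e / 4"
    have "d > 0" "p * e = 4 * d" using p \<open>e > 0\<close> by (auto simp: d_def)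
    then obtain k where k: "\<And>n. n \<ge> k \<Longrightarrow> h n < d"
      using tendsto_0D[OF h0] by blast
    have "N (x (r i) - x (r j)) < e" if "i \<ge> k" "j \<ge> k" for i j
    proof -
      have "p * N (x (r i) - x (r j)) < p * e" unfolding \<open>p * e = 4 * d\<close>
        by (rule le_less_trans[OF est[of i j]]) (use k[OF that(1)] k[OF that(2)] in simp)
      then show ?thesis using p by simp
    qed
    then show "\<exists>k. \<forall>m\<ge>k. \<forall>n\<ge>k. N (x (r m) - x (r n)) < e" by blast
  qed (use x in auto)
  then obtain l where l: "l \<in> V" "(\<lambda>k. N (x (r k) - l)) \<longlonglongrightarrow> 0" by blast
  have "N (A l) \<le> 0"
  proof (rule LIMSEQ_le_const)
    show "(\<lambda>k. C * N (x (r k) - l) + N (A (x (r k)))) \<longlonglongrightarrow> 0"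
      by (rule tendsto_eq_intros Axr l | simp)+
    have "N (A l) \<le> C * N (x (r k) - l) + N (A (x (r k)))" for k
    proof -
      have "A l = A (x (r k)) - A (x (r k) - l)" using lin_on_diff[OF lin(1)] x l by simp
      then have "N (A l) \<le> N (A (x (r k))) + N (A (x (r k) - l))"
        using N_diff_le[of "A (x (r k))" "A (x (r k) - l)"] x l lin_on_V[OF lin(1)] by simp
      then show ?thesis using C(2)[of "x (r k) - l"] x l by simp
    qed
    then show "\<exists>N'. \<forall>k\<ge>N'. N (A l) \<le> C * N (x (r k) - l) + N (A (x (r k)))" by blast
  qed
  then have "A l = 0" using N_nonneg N_eq_0 lin_on_V[OF lin(1) l(1)] by (simp add: order_antisym)
  then have "l = 0" using inj l(1) by (simp add: A_def)
  then have "(\<lambda>k::nat. 1::real) \<longlonglongrightarrow> 0" using l(2) x(2) by simp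
  then show False by (simp add: LIMSEQ_const_iff)
qed

text \<open>If \<open>A = T - \<mu>\<close> is injective and bounded below but not onto, its
  iterated ranges form a strictly decreasing chain of closed subspaces. By construction
  \<open>T\<close> acts as \<open>\<mu>\<close> from each modulo the next, which
  \<open>no_expanding_chain\<close> forbids.\<close>

lemma shift_surj:
  assumes T: "bounded_on T" "near_compact T (cmod \<mu>)" and mu: "\<mu> \<noteq> 0"
    and inj: "\<And>x. x \<in> V \<Longrightarrow> T x - \<mu> \<odot> x = 0 \<Longrightarrow> x = 0"
  shows "(\<lambda>x. T x - \<mu> \<odot> x) ` V = V"
proof (rule ccontr)
  assume neg: "\<not> ?thesis"
  define A where "A = (\<lambda>x. T x - \<mu> \<odot> x)"
  have bA: "bounded_on A" unfolding A_def by (rule bounded_on_shift[OF T(1)])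
  have lin: "lin_on A" "lin_on T" using bA T by (auto simp: bounded_on_def)
  obtain c where c: "c > 0" "\<And>x. x \<in> V \<Longrightarrow> N (A x) \<ge> c * N x"
    using shift_bounded_below[OF T mu inj] unfolding A_def by blast
  have "A ` V \<subseteq> V" using lin_on_V[OF lin(1)] by auto
  then obtain y where y: "y \<in> V" "y \<notin> A ` V" using neg unfolding A_def by blast
  have inj_A: "u = v" if "u \<in> V" "v \<in> V" "A u = A v" for u v
  proof -
    have "A (u - v) = 0" using that lin_on_diff[OF lin(1)] by simp
    then show ?thesis using inj[of "u - v"] that by (simp add: A_def)
  qed
  define U where "U k = (A ^^ k) ` V" for k
  have USuc: "U (Suc k) = A ` U k" for k by (simp add: U_def image_image)
  have clV: "closed_sub V" using subspace_V by (auto simp: closed_sub_def)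
  have cl: "closed_sub (U k)" for k
  proof (induction k)
    case 0
    show ?case using clV by (simp add: U_def)
  next
    case (Suc k)
    show ?case unfolding USuc by (rule closed_sub_image[OF bA c Suc])
  qed
  have UV: "U k \<subseteq> V" and sub: "subspace (U k)" for k using cl[of k] by (auto simp: closed_sub_def)
  have dec: "U (Suc k) \<subseteq> U k" for k
  proof -
    have "(A ^^ Suc k) ` V = (A ^^ k) ` (A ` V)" by (simp only: funpow_Suc_right image_comp)
    then show ?thesis unfolding U_def using \<open>A ` V \<subseteq> V\<close> by (metis image_mono)
  qed
  \<comment> \<open>Injectivity allows one \<open>A\<close> to be cancelled at a time, down to
    \<open>y\<close> being outside the range of \<open>A\<close>.\<close>
  have notin: "(A ^^ k) y \<notin> U (Suc k)" for k
  proof (induction k)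
    case 0
    show ?case using y by (simp add: U_def)
  next
    case (Suc k)
    show ?case
    proof
      assume "(A ^^ Suc k) y \<in> U (Suc (Suc k))"
      then obtain v where "v \<in> U (Suc k)" "A ((A ^^ k) y) = A v" by (auto simp: USuc[of "Suc k"])
      moreover have "(A ^^ k) y \<in> V" using lin_on_V[OF lin_on_pow[OF lin(1)]] y by blast
      ultimately show False using inj_A UV Suc by blast
    qed
  qed
  have strict: "U (Suc k) \<subset> U k" for k
    using dec[of k] notin[of k] y by (auto simp: U_def)
  have AU: "T x - \<mu> \<odot> x \<in> U (Suc k)" if "x \<in> U k" for k x
    using that unfolding USuc by (auto simp: A_def)
  have TU: "T x \<in> U k" if "x \<in> U k" for k x
  proof -
    have "(T x - \<mu> \<odot> x) + \<mu> \<odot> x \<in> U k"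
      using AU[OF that] dec that by (intro subspace_add[OF sub] subspace_scale[OF sub]) auto
    then show ?thesis by simp
  qed
  show False
    by (rule no_expanding_chain[of T "cmod \<mu>" U "\<lambda>_. \<mu>"]) (use lin T mu cl strict TU AU in auto)
qed

text \<open>The set-theoretic inverse is linear because \<open>A\<close> is, and the lower bound
  \<open>c\<close> for \<open>A\<close> is the upper bound \<open>inverse c\<close> for it.\<close>

lemma shift_invertible:
  assumes T: "bounded_on T" "near_compact T (cmod \<mu>)" and mu: "\<mu> \<noteq> 0"
    and inj: "\<And>x. x \<in> V \<Longrightarrow> T x - \<mu> \<odot> x = 0 \<Longrightarrow> x = 0"
  shows "\<exists>S. bounded_on S \<and> (\<forall>x\<in>V. S (T x - \<mu> \<odot> x) = x) \<and> (\<forall>x\<in>V. T (S x) - \<mu> \<odot> S x = x)"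
proof -
  define A where "A = (\<lambda>x. T x - \<mu> \<odot> x)"
  have lin: "lin_on A" unfolding A_def using T by (intro lin_on_shift) (simp add: bounded_on_def)
  obtain c where c: "c > 0" "\<And>x. x \<in> V \<Longrightarrow> N (A x) \<ge> c * N x"
    using shift_bounded_below[OF T mu inj] unfolding A_def by blast
  have surj: "A ` V = V" unfolding A_def by (rule shift_surj[OF T mu inj])
  have inj_A: "inj_on A V"
  proof (rule inj_onI)
    fix u v assume uv: "u \<in> V" "v \<in> V" "A u = A v"
    then have "A (u - v) = 0" using lin_on_diff[OF lin] by simp
    then show "u = v" using inj[of "u - v"] uv by (simp add: A_def)
  qed
  define S where "S = inv_into V A"
  have SV: "S x \<in> V" and AS: "A (S x) = x" if "x \<in> V" for x
    using that surj inv_into_into[of x A V] f_inv_into_f[of x A V] by (auto simp: S_def)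
  have SA: "S (A x) = x" if "x \<in> V" for x
    using inv_into_f_f[OF inj_A that] by (simp add: S_def)
  have "S (x + y) = S x + S y" if "x \<in> V" "y \<in> V" for x y
    using SA[of "S x + S y"] that by (simp add: lin_on_add[OF lin] SV AS)
  moreover have "S (k \<odot> x) = k \<odot> S x" if "x \<in> V" for x k
    using SA[of "k \<odot> S x"] that by (simp add: lin_on_scale[OF lin] SV AS)
  ultimately have "lin_on S" using SV by (auto simp: lin_on_def)
  moreover have "N (S x) \<le> inverse c * N x" if "x \<in> V" for x
    using c(2)[OF SV[OF that]] AS[OF that] c(1) by (simp add: field_simps)
  ultimately have "bounded_on S" unfolding bounded_on_def by blast
  then show ?thesis using SA AS by (auto simp: A_def)
qed

text \<open>After normalising at record times, an unbounded orbit would subconverge in \<open>N\<close> to a unit vector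
  on which the weaker seminorm \<open>p\<close> vanishes.\<close>

lemma orbit_bounded:
  fixes p :: "'v \<Rightarrow> real"
  assumes T: "lin_on T" and nc: "\<And>c. c > 0 \<Longrightarrow> near_compact T c"
    and p: "\<And>x. x \<in> V \<Longrightarrow> p x \<le> N x" "\<And>x. x \<in> V \<Longrightarrow> 0 \<le> p x" "\<And>x. x \<in> V \<Longrightarrow> p x = 0 \<Longrightarrow> x = 0"
      "\<And>x y. x \<in> V \<Longrightarrow> y \<in> V \<Longrightarrow> p (x + y) \<le> p x + p y"
      "\<And>x c. x \<in> V \<Longrightarrow> p (c \<odot> x) = cmod c * p x" "\<And>x. x \<in> V \<Longrightarrow> p (T x) \<le> p x"
    and x: "x \<in> V"
  shows "\<exists>C. \<forall>n. N ((T ^^ n) x) \<le> C"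
proof (rule ccontr)
  assume neg: "\<not> ?thesis"
  define a where "a n = N ((T ^^ n) x)" for n
  have TV: "(T ^^ n) y \<in> V" if "y \<in> V" for n y using lin_on_V[OF lin_on_pow[OF T]] that by blast
  have a0: "a n \<ge> 0" for n using TV x by (simp add: a_def N_nonneg)
  have "\<exists>n. a n > B \<and> (\<forall>m\<le>n. a m \<le> a n)" for B
  proof -
    obtain n' where n': "a n' > B" using neg by (auto simp: a_def not_le)
    have "Max (a ` {..n'}) \<in> a ` {..n'}" by (rule Max_in) auto
    then obtain n where n: "n \<le> n'" "a n = Max (a ` {..n'})" by (metis atMost_iff imageE)
    then have "a m \<le> a n" if "m \<le> n'" for m using that by simp
    then show ?thesis using n(1) n' by (meson le_trans less_le_trans order_refl)
  qed
  \<comment> \<open>The times \<open>q k\<close> are records of the orbit norm. The summand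
    \<open>Suc k\<close> makes the record values grow without bound, and the sum over
    \<open>i \<le> k\<close> forces \<open>q k > k\<close>.\<close>
  then have "\<forall>k. \<exists>n. a n > real (Suc k) + (\<Sum>i\<le>k. a i) \<and> (\<forall>m\<le>n. a m \<le> a n)" by blast
  from choice[OF this] obtain q where
    q: "\<And>k. a (q k) > real (Suc k) + (\<Sum>i\<le>k. a i)" "\<And>k m. m \<le> q k \<Longrightarrow> a m \<le> a (q k)"
    by blast
  have sum_ge: "a m \<le> (\<Sum>i\<le>k. a i)" if "m \<le> k" for m k
    using that a0 by (intro member_le_sum) auto
  have qk: "q k > k" for k
    using q(1)[of k] sum_ge[of "q k" k] by (metis a0 add_less_same_cancel2 leI less_le_trans not_less of_nat_less_0_iff)
  have aq: "a (q k) > real (Suc k)" for k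
    using q(1)[of k] sum_nonneg[of "{..k}" a] a0 by force
  then have aqpos: "a (q k) > 0" for k by (metis less_trans of_nat_0_less_iff zero_less_Suc)
  define s where "s k = complex_of_real (1 / a (q k))" for k
  have s: "cmod (s k) = 1 / a (q k)" for k using aqpos[of k] by (simp add: s_def norm_divide)
  define u where "u k = s k \<odot> (T ^^ q k) x" for k
  have uV: "u k \<in> V" for k using TV x by (simp add: u_def)
  have Nu: "N (u k) = 1" for k
    using aqpos[of k] TV[OF x] by (simp add: u_def N_scale s flip: a_def)
  have pT: "p ((T ^^ n) x) \<le> p x" for n
  proof (induction n)
    case (Suc n)
    then show ?case using p(6)[OF TV[OF x, of n]] by simp
  qed simp
  have pu: "p (u k) \<le> p x * inverse (real (Suc k))" for k
  proof -
    have "p (u k) = (1 / a (q k)) * p ((T ^^ q k) x)" using TV x by (simp add: u_def p(5) s)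
    also have "\<dots> \<le> inverse (real (Suc k)) * p x"
      using aq[of k] aqpos[of k] pT p(2) TV x by (intro mult_mono) (auto simp: field_simps)
    finally show ?thesis by (simp add: mult.commute)
  qed
  \<comment> \<open>\<open>P n t\<close> says that the terms selected by \<open>t\<close> differ by
    less than \<open>1 / (n + 1)\<close>. Any subsequence can be thinned out to satisfy it, and the
    diagonal subsequence will then be Cauchy.\<close>
  define P where "P n t \<longleftrightarrow> (\<forall>i j. N (u (t i) - u (t j)) < inverse (real (Suc n)))" for n and t :: "nat \<Rightarrow> nat"
  interpret subseqs P
  proof
    fix n :: nat and t :: "nat \<Rightarrow> nat"
    assume t: "strict_mono t"
    define e where "e = inverse (real (Suc n))"
    have e: "e > 0" "e \<le> 1" by (auto simp: e_def inverse_le_1_iff)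
    obtain m K where K: "m \<ge> 1" "compact_on K" "\<And>x. x \<in> V \<Longrightarrow> N ((T ^^ m) x - K x) \<le> e ^ m / 8 * N x"
      using nc[OF e(1)] unfolding near_compact_def by blast
    have linK: "lin_on K" using K by (simp add: compact_on_def)
    have em: "e ^ m \<le> e" using e K(1) power_decreasing[of 1 m e] by simp
    \<comment> \<open>The orbit point \<open>m\<close> steps before the record, scaled by the factor
      belonging to the record. Its norm is at most 1 because no earlier time exceeds the record, and
      \<open>T ^^ m\<close> carries it to \<open>u\<close>. The shift of the index by
      \<open>m\<close> ensures that \<open>m\<close> steps back are possible.\<close>
    define v where "v i = s (t (m + i)) \<odot> (T ^^ (q (t (m + i)) - m)) x" for i
    have vV: "v i \<in> V" for i using TV x by (simp add: v_def)
    have Nv: "N (v i) \<le> 1" for i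
    proof -
      have "N (v i) = (1 / a (q (t (m + i)))) * a (q (t (m + i)) - m)"
        using TV x by (simp add: v_def N_scale s a_def)
      also have "\<dots> \<le> (1 / a (q (t (m + i)))) * a (q (t (m + i)))"
        using aqpos[of "t (m + i)"] by (intro mult_left_mono q(2)) auto
      finally show ?thesis using aqpos[of "t (m + i)"] by simp
    qed
    have uv: "u (t (m + i)) = (T ^^ m) (v i)" for i
    proof -
      have "m \<le> q (t (m + i))" using qk[of "t (m + i)"] seq_suble[OF t, of "m + i"] by linarith
      then have "(T ^^ q (t (m + i))) x = (T ^^ m) ((T ^^ (q (t (m + i)) - m)) x)"
        by (metis funpow_add le_add_diff_inverse o_apply)
      then show ?thesis using TV[OF x] by (simp add: u_def v_def lin_on_scale[OF lin_on_pow[OF T]])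
    qed
    obtain r :: "nat \<Rightarrow> nat" where r: "strict_mono r" "\<And>i j. N (K (v (r i)) - K (v (r j))) < e / 2"
    proof -
      have "e / 2 > 0" using e by simp
      from compact_on_close[of K v "e / 2", OF K(2) vV Nv this] that show ?thesis by blast
    qed
    have close: "N (u (t (m + i)) - K (v i)) \<le> e / 8" for i
    proof -
      have "N (u (t (m + i)) - K (v i)) \<le> e ^ m / 8 * N (v i)" unfolding uv by (rule K(3)[OF vV])
      also have "\<dots> \<le> e / 8 * 1" using em e Nv[of i] vV[of i] by (intro mult_mono) (auto simp: N_nonneg)
      finally show ?thesis by simp
    qed
    have "N (u (t (m + r i)) - u (t (m + r j))) < e" for i j
    proof -
      note V = uV vV lin_on_V[OF linK]
      have "N (u (t (m + r i)) - u (t (m + r j)))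
         \<le> N (u (t (m + r i)) - K (v (r i))) + N (K (v (r i)) - u (t (m + r j)))"
        by (rule N_triangle_diff) (auto simp: V)
      also have "N (K (v (r i)) - u (t (m + r j)))
         \<le> N (K (v (r i)) - K (v (r j))) + N (K (v (r j)) - u (t (m + r j)))"
        by (rule N_triangle_diff) (auto simp: V)
      also have "N (K (v (r j)) - u (t (m + r j))) = N (u (t (m + r j)) - K (v (r j)))"
        by (rule N_commute) (auto simp: V)
      finally show ?thesis using close[of "r i"] close[of "r j"] r(2)[of i j] e by linarith
    qed
    then have "P n (t \<circ> (\<lambda>i. m + r i))" by (simp add: P_def e_def)
    moreover have "strict_mono (\<lambda>i. m + r i)" using r(1) by (auto simp: strict_mono_def)
    ultimately show "\<exists>r'. strict_mono r' \<and> P n (t \<circ> r')" by blast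
  qed
  have P: "P k (diagseq \<circ> (+) (Suc k))" for k
    by (rule diagseq_holds) (auto simp: P_def)
  define w where "w k = u (diagseq k)" for k
  have "\<exists>l\<in>V. (\<lambda>n. N (w n - l)) \<longlonglongrightarrow> 0"
  proof (rule complete)
    fix e :: real assume "e > 0"
    then obtain k where k: "inverse (real (Suc k)) < e" using reals_Archimedean by blast
    have "N (w m - w n) < e" if "m \<ge> Suc k" "n \<ge> Suc k" for m n
    proof -
      have "N (u (diagseq (Suc k + (m - Suc k))) - u (diagseq (Suc k + (n - Suc k)))) < inverse (real (Suc k))"
        using P[of k] unfolding P_def o_def by blast
      then show ?thesis using k that by (simp add: w_def)
    qed
    then show "\<exists>k. \<forall>m\<ge>k. \<forall>n\<ge>k. N (w m - w n) < e" by blast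
  qed (use uV in \<open>simp add: w_def\<close>)
  then obtain l where l: "l \<in> V" "(\<lambda>n. N (w n - l)) \<longlonglongrightarrow> 0" by blast
  have wV: "w k \<in> V" for k using uV by (simp add: w_def)
  \<comment> \<open>\<open>T\<close> does not increase \<open>p\<close>, while the normalising
    factors tend to 0; so \<open>p (w k)\<close> tends to 0, and \<open>p\<close> is dominated by
    \<open>N\<close>.\<close>
  have "p l \<le> 0"
  proof (rule LIMSEQ_le_const)
    show "(\<lambda>k. N (w k - l) + p x * inverse (real (Suc k))) \<longlonglongrightarrow> 0"
      using tendsto_add[OF l(2) tendsto_mult[OF tendsto_const[of "p x"] LIMSEQ_inverse_real_of_nat]] by simp
    have "p l \<le> N (w k - l) + p x * inverse (real (Suc k))" for k
    proof -
      have "p l \<le> p (l - w k) + p (w k)" using p(4)[of "l - w k" "w k"] l wV by simp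
      also have "p (l - w k) \<le> N (w k - l)" using p(1)[of "l - w k"] l wV N_commute by simp
      also have "p (w k) \<le> p x * inverse (real (Suc (diagseq k)))" using pu by (simp add: w_def)
      also have "\<dots> \<le> p x * inverse (real (Suc k))"
        using p(2)[OF x] seq_suble[OF subseq_diagseq, of k] by (intro mult_left_mono) auto
      finally show ?thesis by simp
    qed
    then show "\<exists>N'. \<forall>k\<ge>N'. p l \<le> N (w k - l) + p x * inverse (real (Suc k))" by blast
  qed
  then have "l = 0" using p(2,3)[OF l(1)] by linarith
  then have "(\<lambda>k::nat. 1::real) \<longlonglongrightarrow> 0" using l(2) Nu by (simp add: w_def)
  then show False by (simp add: LIMSEQ_const_iff)
qed

end

section \<open>Mean value estimates and completeness of \<open>D(X,M)\<close>\<close>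

text \<open>The sums under the supremum in \<open>arc_length\<close>, but for an arbitrary parameter
  interval, so that they can be concatenated.\<close>

definition partition_sum :: "(real \<Rightarrow> complex) \<Rightarrow> real \<Rightarrow> real \<Rightarrow> real \<Rightarrow> bool" where
  "partition_sum g a b s \<longleftrightarrow> (\<exists>k t. s = (\<Sum>i<k. cmod (g (t (Suc i)) - g (t i))) \<and>
      t 0 = a \<and> t k = b \<and> (\<forall>i<k. t i \<le> t (Suc i)))"

lemma partition_sum_trans:
  assumes "partition_sum g a b r" "partition_sum g b c s"
  shows "partition_sum g a c (r + s)"
proof -
  obtain k t where t: "r = (\<Sum>i<k. cmod (g (t (Suc i)) - g (t i)))" "t 0 = a" "t k = b" "\<forall>i<k. t i \<le> t (Suc i)"
    using assms(1) unfolding partition_sum_def by blast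
  obtain m u where u: "s = (\<Sum>i<m. cmod (g (u (Suc i)) - g (u i)))" "u 0 = b" "u m = c" "\<forall>i<m. u i \<le> u (Suc i)"
    using assms(2) unfolding partition_sum_def by blast
  define v where "v i = (if i \<le> k then t i else u (i - k))" for i
  have v1: "v i = t i" if "i \<le> k" for i using that by (simp add: v_def)
  have v2: "v (k + i) = u i" for i using t u by (simp add: v_def)
  have v3: "v (Suc (k + i)) = u (Suc i)" for i using v2[of "Suc i"] by simp
  have split: "(\<Sum>i<k + n. f i) = (\<Sum>i<k. f i) + (\<Sum>i<n. f (k + i))" for n and f :: "nat \<Rightarrow> real"
    by (induction n) (auto simp: add.assoc)
  have "(\<Sum>i<k + m. cmod (g (v (Suc i)) - g (v i))) = r + s"
    by (simp add: split v1 v2 v3 t(1) u(1))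
  moreover have "v 0 = a" "v (k + m) = c" using t u by (auto simp: v1 v2)
  moreover have "v i \<le> v (Suc i)" if "i < k + m" for i
  proof (cases "i < k")
    case True
    then show ?thesis using t by (simp add: v1)
  next
    case False
    then obtain j where j: "i = k + j" using le_Suc_ex not_less by blast
    then show ?thesis using u that by (simp add: v2 v3)
  qed
  ultimately show ?thesis unfolding partition_sum_def by metis
qed

lemma partition_sum_segment: "a \<le> b \<Longrightarrow> partition_sum g a b (cmod (g b - g a))"
  unfolding partition_sum_def
  by (intro exI[of _ 1] exI[of _ "\<lambda>i::nat. if i = 0 then a else b"]) auto

lemma partition_sum_le_arc_length:
  assumes "rectifiable g" "partition_sum g 0 1 s"
  shows "s \<le> arc_length g"
  unfolding arc_length_def
  by (rule cSup_upper) (use assms in \<open>auto simp: rectifiable_def partition_sum_def\<close>)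

lemma dist_start_le_arc_length:
  assumes "rectifiable g" "t \<in> {0..1}"
  shows "cmod (g t - g 0) \<le> arc_length g"
proof -
  have "partition_sum g 0 1 (cmod (g t - g 0) + cmod (g 1 - g t))"
    using assms(2) by (intro partition_sum_trans[of _ _ t] partition_sum_segment) auto
  from partition_sum_le_arc_length[OF assms(1) this] show ?thesis
    using norm_ge_zero[of "g 1 - g t"] by linarith
qed

lemma has_field_derivative_local_bound:
  fixes f :: "complex \<Rightarrow> complex"
  assumes "(f has_field_derivative D) (at z within X)" "e > 0"
  shows "\<exists>d>0. \<forall>w\<in>X. cmod (w - z) < d \<longrightarrow> cmod (f w - f z) \<le> (cmod D + e) * cmod (w - z)"
proof -
  obtain d where d: "d > 0" "\<And>w. w \<in> X \<Longrightarrow> cmod (w - z) < d \<Longrightarrow>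
      cmod (f w - f z - D * (w - z)) \<le> e * cmod (w - z)"
    using assms unfolding has_field_derivative_def has_derivative_within_alt by blast
  have "cmod (f w - f z) \<le> (cmod D + e) * cmod (w - z)" if "w \<in> X" "cmod (w - z) < d" for w
    using d(2)[OF that] norm_triangle_ineq[of "f w - f z - D * (w - z)" "D * (w - z)"]
    by (simp add: norm_mult distrib_right)
  then show ?thesis using d(1) by blast
qed

text \<open>The arc \<open>g\<close> need not be differentiable, so the estimate is made by
  bisection: near each parameter the derivative bounds increments of \<open>f\<close> by
  \<open>B + e\<close> times increments of \<open>g\<close>, and such estimates add up along a
  partition. Then \<open>e\<close> tends to 0.\<close>

lemma mean_value_along_arc:
  fixes f :: "complex \<Rightarrow> complex"
  assumes g: "rectifiable g" "path g" "path_image g \<subseteq> X"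
    and f: "\<And>z. z \<in> X \<Longrightarrow> (f has_field_derivative f' z) (at z within X)"
    and B: "\<And>t. t \<in> {0..1} \<Longrightarrow> cmod (f' (g t)) \<le> B"
  shows "cmod (f (g 1) - f (g 0)) \<le> B * arc_length g"
proof -
  have gX: "g t \<in> X" if "t \<in> {0..1}" for t using g(3) that by (auto simp: path_image_def)
  have cont: "continuous_on {0..1} g" using g(2) by (simp add: path_def)
  have B0: "B \<ge> 0" using B[of 0] norm_ge_zero by (meson atLeastAtMost_iff order_trans zero_le_one order_refl)
  have L0: "arc_length g \<ge> 0" using dist_start_le_arc_length[OF g(1), of 0] by simp
  have est: "cmod (f (g 1) - f (g 0)) \<le> (B + e) * arc_length g" if e: "e > 0" for e
  proof -
    \<comment> \<open>A single partition sum \<open>s\<close> plays the part of the length of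
      \<open>g\<close> over \<open>[a, b]\<close>; concatenation of sums gives the transitivity
      required by \<open>Bolzano\<close>.\<close>
    define P where "P a b \<longleftrightarrow> (0 \<le> a \<and> b \<le> 1 \<longrightarrow>
      (\<exists>s. partition_sum g a b s \<and> cmod (f (g b) - f (g a)) \<le> (B + e) * s))" for a b
    have "(0::real) \<le> 1" by simp
    then have "P 0 1"
    proof (induction rule: Bolzano)
      case (trans a b c)
      show ?case unfolding P_def
      proof
        assume "0 \<le> a \<and> c \<le> 1"
        then obtain r s where "partition_sum g a b r" "cmod (f (g b) - f (g a)) \<le> (B + e) * r"
          "partition_sum g b c s" "cmod (f (g c) - f (g b)) \<le> (B + e) * s"
          using trans unfolding P_def by auto
        moreover have "cmod (f (g c) - f (g a)) \<le> cmod (f (g c) - f (g b)) + cmod (f (g b) - f (g a))"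
          using norm_triangle_ineq[of "f (g c) - f (g b)" "f (g b) - f (g a)"] by simp
        ultimately show "\<exists>s. partition_sum g a c s \<and> cmod (f (g c) - f (g a)) \<le> (B + e) * s"
          by (intro exI[of _ "r + s"] conjI partition_sum_trans[of g a b r c s]) (auto simp: algebra_simps)
      qed
    next
      case (local x)
      then have x: "x \<in> {0..1}" by simp
      obtain d where d: "d > 0" "\<And>w. w \<in> X \<Longrightarrow> cmod (w - g x) < d \<Longrightarrow>
          cmod (f w - f (g x)) \<le> (cmod (f' (g x)) + e) * cmod (w - g x)"
        using has_field_derivative_local_bound[OF f[OF gX[OF x]] e] by blast
      obtain c where c: "c > 0" "\<And>t. t \<in> {0..1} \<Longrightarrow> \<bar>t - x\<bar> < c \<Longrightarrow> cmod (g t - g x) < d"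
        using cont x d(1) unfolding continuous_on_iff dist_norm real_norm_def by meson
      have le: "cmod (f (g t) - f (g x)) \<le> (B + e) * cmod (g t - g x)"
        if "t \<in> {0..1}" "\<bar>t - x\<bar> < c" for t
      proof -
        have "cmod (f (g t) - f (g x)) \<le> (cmod (f' (g x)) + e) * cmod (g t - g x)"
          by (rule d(2)[OF gX[OF that(1)] c(2)[OF that]])
        also have "\<dots> \<le> (B + e) * cmod (g t - g x)"
          using B[OF x] by (intro mult_right_mono) auto
        finally show ?thesis .
      qed
      \<comment> \<open>Differentiability at \<open>g x\<close> controls only increments starting
        from \<open>g x\<close>, so the interval is split at \<open>x\<close>.\<close>
      have "P a b" if ab: "a \<le> x" "x \<le> b" "b - a < c" for a b
        unfolding P_def
      proof
        assume "0 \<le> a \<and> b \<le> 1"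
        then have 1: "cmod (f (g a) - f (g x)) \<le> (B + e) * cmod (g a - g x)"
          and 2: "cmod (f (g b) - f (g x)) \<le> (B + e) * cmod (g b - g x)"
          using ab by (auto intro!: le)
        have "cmod (f (g b) - f (g a)) \<le> cmod (f (g b) - f (g x)) + cmod (f (g a) - f (g x))"
          using norm_triangle_ineq4[of "f (g b) - f (g x)" "f (g a) - f (g x)"] by simp
        also have "\<dots> \<le> (B + e) * (cmod (g x - g a) + cmod (g b - g x))"
          using 1 2 by (simp add: algebra_simps norm_minus_commute)
        finally show "\<exists>s. partition_sum g a b s \<and> cmod (f (g b) - f (g a)) \<le> (B + e) * s"
          using ab by (blast intro: partition_sum_trans partition_sum_segment)
      qed
      then show ?case using c(1) by blast
    qed
    then obtain s where s: "partition_sum g 0 1 s" "cmod (f (g 1) - f (g 0)) \<le> (B + e) * s"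
      unfolding P_def by auto
    note s(2)
    also have "(B + e) * s \<le> (B + e) * arc_length g"
      using partition_sum_le_arc_length[OF g(1) s(1)] B0 e by (intro mult_left_mono) auto
    finally show ?thesis .
  qed
  show ?thesis
  proof (rule field_le_epsilon)
    fix e :: real assume e: "e > 0"
    define e' where "e' = e / (arc_length g + 1)"
    have "e' > 0" using e L0 by (simp add: e'_def)
    from est[OF this] have "cmod (f (g 1) - f (g 0)) \<le> B * arc_length g + e' * arc_length g"
      by (simp add: algebra_simps)
    also have "e' * arc_length g \<le> e"
      using e L0 by (simp add: e'_def field_simps)
    finally show "cmod (f (g 1) - f (g 0)) \<le> B * arc_length g + e" by simp
  qed
qed

lemma uniformly_regular_connected:
  assumes "uniformly_regular X"
  shows "connected X"
proof -
  have "path_connected X" unfolding path_connected_def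
  proof (intro ballI)
    fix x y assume xy: "x \<in> X" "y \<in> X"
    show "\<exists>g. path g \<and> path_image g \<subseteq> X \<and> pathstart g = x \<and> pathfinish g = y"
    proof (cases "x = y")
      case True
      then show ?thesis using xy by (intro exI[of _ "\<lambda>_. x"]) (auto simp: path_def path_image_def pathstart_def pathfinish_def)
    next
      case False
      then show ?thesis using assms xy unfolding uniformly_regular_def rect_arc_in_def arc_def by meson
    qed
  qed
  then show ?thesis by (rule path_connected_imp_connected)
qed

text \<open>Join \<open>z\<close> to \<open>w\<close> by an arc of length at most
  \<open>C * cmod (w - z)\<close>. The whole arc stays that close to \<open>z\<close>, so the
  derivative has to be bounded only there; the Taylor estimate relies on this localisation.\<close>

lemma uniformly_regular_mean_value:
  assumes "uniformly_regular X"
  obtains C where "C > 0" "\<And>(f :: complex \<Rightarrow> complex) f' B z w.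
    (\<And>u. u \<in> X \<Longrightarrow> (f has_field_derivative f' u) (at u within X)) \<Longrightarrow> z \<in> X \<Longrightarrow> w \<in> X \<Longrightarrow>
    (\<And>u. u \<in> X \<Longrightarrow> cmod (u - z) \<le> C * cmod (w - z) \<Longrightarrow> cmod (f' u) \<le> B) \<Longrightarrow>
    cmod (f w - f z) \<le> B * (C * cmod (w - z))"
proof -
  obtain C0 where C0: "\<And>z w. z \<in> X \<Longrightarrow> w \<in> X \<Longrightarrow> geodesic_dist X z w \<le> C0 * cmod (z - w)"
    using assms unfolding uniformly_regular_def by blast
  \<comment> \<open>Strictly larger than \<open>C0\<close>: the geodesic distance is an infimum, and
    the slack provides an actual arc.\<close>
  define C where "C = \<bar>C0\<bar> + 1"
  have arcs: "\<exists>g. rect_arc_in X z w g \<and> arc_length g \<le> C * cmod (w - z)"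
    if zw: "z \<in> X" "w \<in> X" "z \<noteq> w" for z w
  proof -
    have ne: "{arc_length g | g. rect_arc_in X z w g} \<noteq> {}"
      using assms zw unfolding uniformly_regular_def by blast
    have "Inf {arc_length g | g. rect_arc_in X z w g} \<le> C0 * cmod (z - w)"
      using C0[OF zw(1,2)] zw by (simp add: geodesic_dist_def)
    also have "\<dots> < C * cmod (z - w)"
      using zw by (intro mult_strict_right_mono) (auto simp: C_def)
    finally obtain g where "rect_arc_in X z w g" "arc_length g < C * cmod (z - w)"
      using cInf_lessD[OF ne] by blast
    then show ?thesis by (auto simp: norm_minus_commute intro!: exI[of _ g])
  qed
  have C: "C > 0" by (simp add: C_def)
  show ?thesis
  proof (rule that[OF C])
    fix f :: "complex \<Rightarrow> complex" and f' B z w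
    assume f: "\<And>u. u \<in> X \<Longrightarrow> (f has_field_derivative f' u) (at u within X)" and zw: "z \<in> X" "w \<in> X"
      and B: "\<And>u. u \<in> X \<Longrightarrow> cmod (u - z) \<le> C * cmod (w - z) \<Longrightarrow> cmod (f' u) \<le> B"
    show "cmod (f w - f z) \<le> B * (C * cmod (w - z))"
    proof (cases "z = w")
      case False
      then obtain g where g: "rect_arc_in X z w g" "arc_length g \<le> C * cmod (w - z)"
        using arcs zw by blast
      then have g': "rectifiable g" "path g" "path_image g \<subseteq> X" "g 0 = z" "g 1 = w"
        by (auto simp: rect_arc_in_def arc_def pathstart_def pathfinish_def)
      have B': "cmod (f' (g t)) \<le> B" if t: "t \<in> {0..1}" for t
      proof (rule B)
        show "g t \<in> X" using g'(3) t by (auto simp: path_image_def)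
        show "cmod (g t - z) \<le> C * cmod (w - z)"
          using dist_start_le_arc_length[OF g'(1) t] g(2) g'(4) by simp
      qed
      have B0: "B \<ge> 0" using B'[of 0] by (meson atLeastAtMost_iff norm_ge_zero order_refl order_trans zero_le_one)
      have "cmod (f (g 1) - f (g 0)) \<le> B * arc_length g"
        by (rule mean_value_along_arc[OF g'(1-3) f B'])
      also have "\<dots> \<le> B * (C * cmod (w - z))" using g(2) B0 by (rule mult_left_mono)
      finally show ?thesis using g' by simp
    qed simp
  qed
qed

section \<open>Iterated derivatives on X and the normed space D(X,M)\<close>

locale regular_weight =
  fixes X :: "complex set" and M :: "nat \<Rightarrow> real"
  assumes reg: "uniformly_regular X" and weight: "weight_seq M"
begin

text \<open>A candidate list of successive derivatives. It serves as a certificate for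
  \<open>Dinf\<close> and computes \<open>nderivX\<close>, which itself is built from a choice
  operator.\<close>

definition deriv_chain :: "(nat \<Rightarrow> complex \<Rightarrow> complex) \<Rightarrow> bool" where
  "deriv_chain F \<longleftrightarrow> (\<forall>n. \<forall>z\<in>X. (F n has_field_derivative F (Suc n) z) (at z within X))"

lemma M_pos [simp]: "M n > 0" and M_0 [simp]: "M 0 = 1"
  using weight by (auto simp: weight_seq_def)

lemma compact_X: "compact X" and X_nonempty: "X \<noteq> {}"
  using reg by (auto simp: uniformly_regular_def)

text \<open>A connected set with more than one point has no isolated points. This makes derivatives
  within X unique, so the choice in \<open>derivX\<close> is determined.\<close>

lemma limpt_X: "z \<in> X \<Longrightarrow> z islimpt X"
  using connected_imp_perfect[OF uniformly_regular_connected[OF reg]] reg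
  unfolding uniformly_regular_def by (metis singletonD)

lemma derivX_eq: "z \<in> X \<Longrightarrow> (f has_field_derivative D) (at z within X) \<Longrightarrow> derivX X f z = D"
  unfolding derivX_def using limpt_X trivial_limit_within
  by (intro some_equality) (auto intro: has_field_derivative_unique)

text \<open>Uniqueness of derivatives carries the agreement from one order to the next. It is
  claimed on X only: off X the value of \<open>derivX\<close> may depend on the choice.\<close>

lemma deriv_chain_nderivX:
  assumes "deriv_chain F" "\<And>z. z \<in> X \<Longrightarrow> F 0 z = f z" "z \<in> X"
  shows "nderivX X n f z = F n z"
  using assms(3)
proof (induction n arbitrary: z)
  case 0
  then show ?case using assms by (simp add: nderivX_def)
next
  case (Suc n)
  have "(nderivX X n f has_field_derivative F (Suc n) z) (at z within X)"
    by (rule has_field_derivative_transform_within[of "F n" _ _ _ 1])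
       (use assms(1) Suc in \<open>auto simp: deriv_chain_def\<close>)
  then show ?case using derivX_eq Suc.prems by (simp add: nderivX_def)
qed

lemma Dinf_deriv_chain: "Dinf X f \<Longrightarrow> deriv_chain (\<lambda>n. nderivX X n f)"
  by (simp add: Dinf_def deriv_chain_def)

lemma deriv_chain_Dinf:
  assumes "deriv_chain F" "\<And>z. z \<in> X \<Longrightarrow> F 0 z = f z"
  shows "Dinf X f"
  unfolding Dinf_def
proof (intro allI ballI)
  fix n z assume z: "z \<in> X"
  have "(nderivX X n f has_field_derivative F (Suc n) z) (at z within X)"
    by (rule has_field_derivative_transform_within[of "F n" _ _ _ 1])
       (use assms z deriv_chain_nderivX[OF assms] in \<open>auto simp: deriv_chain_def\<close>)
  then show "(nderivX X n f has_field_derivative nderivX X (Suc n) f z) (at z within X)"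
    using deriv_chain_nderivX[OF assms z] by simp
qed

lemma deriv_chain_continuous: "deriv_chain F \<Longrightarrow> continuous_on X (F n)"
  unfolding deriv_chain_def continuous_on_eq_continuous_within
  by (blast intro: DERIV_continuous)

lemma supX_upper: "continuous_on X f \<Longrightarrow> z \<in> X \<Longrightarrow> cmod (f z) \<le> supX X f"
  unfolding supX_def
  by (rule cSup_upper)
     (auto intro!: bounded_imp_bdd_above compact_imp_bounded compact_continuous_image compact_X continuous_intros)

lemma supX_least: "(\<And>z. z \<in> X \<Longrightarrow> cmod (f z) \<le> B) \<Longrightarrow> supX X f \<le> B"
  unfolding supX_def by (rule cSup_least) (use X_nonempty in auto)

lemma supX_cong: "(\<And>z. z \<in> X \<Longrightarrow> f z = g z) \<Longrightarrow> supX X f = supX X g"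
  unfolding supX_def by (metis (no_types, lifting) image_cong)

lemma supX_nonneg: "continuous_on X f \<Longrightarrow> supX X f \<ge> 0"
  using X_nonempty supX_upper by (meson all_not_in_conv norm_ge_zero order_trans)

lemma Dspace_chain:
  assumes "f \<in> Dspace X M"
  shows "deriv_chain (\<lambda>n. nderivX X n f)" "summable (\<lambda>n. supX X (nderivX X n f) / M n)" "z \<notin> X \<Longrightarrow> f z = 0"
    "continuous_on X (nderivX X n f)" "nderivX X 0 f = f"
  using assms Dinf_deriv_chain deriv_chain_continuous unfolding Dspace_def nderivX_def by auto

lemma Dspace_chainI:
  assumes "deriv_chain F" "\<And>z. z \<in> X \<Longrightarrow> F 0 z = f z" "\<And>z. z \<notin> X \<Longrightarrow> f z = 0"
    "summable (\<lambda>n. supX X (F n) / M n)"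
  shows "f \<in> Dspace X M" "normD X M f = (\<Sum>n. supX X (F n) / M n)"
proof -
  have eq: "supX X (nderivX X n f) = supX X (F n)" for n
    by (rule supX_cong) (rule deriv_chain_nderivX[OF assms(1,2)])
  show "f \<in> Dspace X M" unfolding Dspace_def
    using assms eq deriv_chain_Dinf[OF assms(1,2)] by simp
  show "normD X M f = (\<Sum>n. supX X (F n) / M n)" unfolding normD_def by (simp add: eq)
qed

lemma sup_term_nonneg: "f \<in> Dspace X M \<Longrightarrow> 0 \<le> supX X (nderivX X n f) / M n"
  by (intro divide_nonneg_pos supX_nonneg Dspace_chain M_pos)

lemma sum_le_normD: "f \<in> Dspace X M \<Longrightarrow> (\<Sum>k<n. supX X (nderivX X k f) / M k) \<le> normD X M f"
  unfolding normD_def by (rule sum_le_suminf) (auto intro: Dspace_chain sup_term_nonneg)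

lemma supX_le_normD: "f \<in> Dspace X M \<Longrightarrow> supX X (nderivX X n f) \<le> M n * normD X M f"
proof -
  assume f: "f \<in> Dspace X M"
  have "supX X (nderivX X n f) / M n \<le> (\<Sum>k<Suc n. supX X (nderivX X k f) / M k)"
    using sum_nonneg[of "{..<n}" "\<lambda>k. supX X (nderivX X k f) / M k"] sup_term_nonneg[OF f] by simp
  also have "\<dots> \<le> normD X M f" by (rule sum_le_normD[OF f])
  finally show ?thesis by (simp add: field_simps)
qed

lemma nderivX_le_normD: "f \<in> Dspace X M \<Longrightarrow> z \<in> X \<Longrightarrow> cmod (nderivX X n f z) \<le> M n * normD X M f"
  using supX_upper[OF Dspace_chain(4)] supX_le_normD by (meson order_trans)

lemma Dspace_add:
  assumes f: "f \<in> Dspace X M" and g: "g \<in> Dspace X M"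
  shows "f + g \<in> Dspace X M" "normD X M (f + g) \<le> normD X M f + normD X M g"
    "z \<in> X \<Longrightarrow> nderivX X n (f + g) z = nderivX X n f z + nderivX X n g z"
proof -
  let ?F = "\<lambda>n z. nderivX X n f z + nderivX X n g z"
  have ch: "deriv_chain ?F"
    using Dspace_chain(1)[OF f] Dspace_chain(1)[OF g] unfolding deriv_chain_def by (auto intro: DERIV_add)
  have 0: "?F 0 z = (f + g) z" for z by (simp add: nderivX_def)
  have le: "supX X (?F n) / M n \<le> supX X (nderivX X n f) / M n + supX X (nderivX X n g) / M n" for n
  proof -
    have "supX X (?F n) \<le> supX X (nderivX X n f) + supX X (nderivX X n g)"
      using supX_upper[OF Dspace_chain(4)[OF f]] supX_upper[OF Dspace_chain(4)[OF g]]
      by (intro supX_least) (meson add_mono norm_triangle_le)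
    then show ?thesis by (simp add: divide_right_mono less_imp_le flip: add_divide_distrib)
  qed
  have sm: "summable (\<lambda>n. supX X (nderivX X n f) / M n + supX X (nderivX X n g) / M n)"
    by (intro summable_add Dspace_chain f g)
  have sm': "summable (\<lambda>n. supX X (?F n) / M n)"
    by (rule summable_comparison_test'[OF sm, of 0])
       (use le supX_nonneg[OF deriv_chain_continuous[OF ch]] in \<open>auto simp: abs_of_nonneg abs_of_pos[OF M_pos]\<close>)
  have off: "(f + g) z = 0" if "z \<notin> X" for z using Dspace_chain(3)[OF f] Dspace_chain(3)[OF g] that by simp
  show "f + g \<in> Dspace X M" by (rule Dspace_chainI[OF ch 0 off sm'])
  have "normD X M (f + g) = (\<Sum>n. supX X (?F n) / M n)" by (rule Dspace_chainI[OF ch 0 off sm'])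
  also have "\<dots> \<le> (\<Sum>n. supX X (nderivX X n f) / M n + supX X (nderivX X n g) / M n)"
    by (rule suminf_le[OF le sm' sm])
  also have "\<dots> = normD X M f + normD X M g"
    unfolding normD_def by (rule suminf_add[symmetric]) (intro Dspace_chain f g)+
  finally show "normD X M (f + g) \<le> normD X M f + normD X M g" .
  show "nderivX X n (f + g) z = nderivX X n f z + nderivX X n g z" if "z \<in> X"
    using deriv_chain_nderivX[of _ "f + g", OF ch 0 that] by simp
qed

lemma supX_scale:
  assumes "continuous_on X f"
  shows "supX X (\<lambda>z. c * f z) = cmod c * supX X f"
proof (rule antisym)
  have cont: "continuous_on X (\<lambda>z. c * f z)" using assms by (intro continuous_intros)
  show "supX X (\<lambda>z. c * f z) \<le> cmod c * supX X f"
    using supX_upper[OF assms] by (intro supX_least) (simp add: norm_mult mult_left_mono)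
  show "cmod c * supX X f \<le> supX X (\<lambda>z. c * f z)"
  proof (cases "c = 0")
    case True
    then show ?thesis using supX_nonneg[OF cont] by simp
  next
    case False
    have "supX X f \<le> supX X (\<lambda>z. c * f z) / cmod c"
      using supX_upper[OF cont] False by (intro supX_least) (simp add: norm_mult field_simps)
    then show ?thesis using False by (simp add: field_simps)
  qed
qed

lemma Dspace_scale:
  assumes f: "f \<in> Dspace X M"
  shows "(\<lambda>z. c * f z) \<in> Dspace X M" "normD X M (\<lambda>z. c * f z) = cmod c * normD X M f"
    "z \<in> X \<Longrightarrow> nderivX X n (\<lambda>z. c * f z) z = c * nderivX X n f z"
proof -
  let ?F = "\<lambda>n z. c * nderivX X n f z"
  have ch: "deriv_chain ?F"
    using Dspace_chain(1)[OF f] unfolding deriv_chain_def by (auto intro: DERIV_cmult)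
  have 0: "?F 0 z = c * f z" for z by (simp add: nderivX_def)
  have sup: "supX X (?F n) = cmod c * supX X (nderivX X n f)" for n
    by (rule supX_scale[OF Dspace_chain(4)[OF f]])
  have sm: "summable (\<lambda>n. supX X (nderivX X n f) / M n)" by (rule Dspace_chain[OF f])
  have sm': "summable (\<lambda>n. supX X (?F n) / M n)"
    unfolding sup times_divide_eq_right[symmetric] by (rule summable_mult[OF sm])
  have off: "c * f z = 0" if "z \<notin> X" for z using Dspace_chain(3)[OF f] that by simp
  show "(\<lambda>z. c * f z) \<in> Dspace X M" by (rule Dspace_chainI[OF ch 0 off sm'])
  have "normD X M (\<lambda>z. c * f z) = (\<Sum>n. supX X (?F n) / M n)" by (rule Dspace_chainI[OF ch 0 off sm'])
  also have "\<dots> = cmod c * normD X M f"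
    unfolding normD_def sup times_divide_eq_right[symmetric] by (rule suminf_mult[OF sm])
  finally show "normD X M (\<lambda>z. c * f z) = cmod c * normD X M f" .
  show "nderivX X n (\<lambda>z. c * f z) z = c * nderivX X n f z" if "z \<in> X"
    using deriv_chain_nderivX[OF ch 0 that] by simp
qed

lemma Dspace_diff:
  assumes f: "f \<in> Dspace X M" and g: "g \<in> Dspace X M"
  shows "f - g \<in> Dspace X M"
    "z \<in> X \<Longrightarrow> nderivX X n (f - g) z = nderivX X n f z - nderivX X n g z"
proof -
  have eq: "f - g = f + (\<lambda>z. (- 1) * g z)" by (simp add: fun_eq_iff)
  note g' = Dspace_scale(1)[OF g, of "-1"]
  show "f - g \<in> Dspace X M" unfolding eq by (rule Dspace_add(1)[OF f g'])
  show "nderivX X n (f - g) z = nderivX X n f z - nderivX X n g z" if "z \<in> X"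
    unfolding eq Dspace_add(3)[OF f g' that] Dspace_scale(3)[OF g that] by simp
qed

lemma normD_nonneg: "f \<in> Dspace X M \<Longrightarrow> 0 \<le> normD X M f"
  unfolding normD_def by (intro suminf_nonneg Dspace_chain sup_term_nonneg)

lemma cmod_le_normD: "f \<in> Dspace X M \<Longrightarrow> z \<in> X \<Longrightarrow> cmod (f z) \<le> normD X M f"
  using nderivX_le_normD[of f z 0] by (simp add: nderivX_def)

lemma zero_in_Dspace: "0 \<in> Dspace X M"
proof (rule Dspace_chainI)
  show "deriv_chain (\<lambda>_. 0)" unfolding deriv_chain_def by (simp add: zero_fun_def)
  have "supX X 0 = 0" unfolding supX_def using X_nonempty by simp
  then show "summable (\<lambda>n. supX X 0 / M n)" by simp
qed simp_all

section \<open>Completeness of D(X,M)\<close>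

text \<open>The mean value estimate for \<open>G n - G k\<close>, whose derivative is at most
  \<open>2 * e'\<close>, survives the limit in \<open>n\<close>. So difference quotients of
  \<open>g\<close> are compared with those of the one function \<open>G k\<close>.\<close>

lemma deriv_of_uniform_limit:
  fixes G :: "nat \<Rightarrow> complex \<Rightarrow> complex"
  assumes der: "\<And>n z. z \<in> X \<Longrightarrow> (G n has_field_derivative G' n z) (at z within X)"
    and lim: "\<And>z. z \<in> X \<Longrightarrow> (\<lambda>n. G n z) \<longlonglongrightarrow> g z"
    and unif: "\<And>e. e > 0 \<Longrightarrow> \<exists>k. \<forall>n\<ge>k. \<forall>z\<in>X. cmod (G' n z - g' z) \<le> e"
    and z: "z \<in> X"
  shows "(g has_field_derivative g' z) (at z within X)"
proof -
  obtain C where C: "C > 0" "\<And>(f :: complex \<Rightarrow> complex) f' B z w.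
    (\<And>u. u \<in> X \<Longrightarrow> (f has_field_derivative f' u) (at u within X)) \<Longrightarrow> z \<in> X \<Longrightarrow> w \<in> X \<Longrightarrow>
    (\<And>u. u \<in> X \<Longrightarrow> cmod (u - z) \<le> C * cmod (w - z) \<Longrightarrow> cmod (f' u) \<le> B) \<Longrightarrow>
    cmod (f w - f z) \<le> B * (C * cmod (w - z))"
    using uniformly_regular_mean_value[OF reg] by blast
  show ?thesis unfolding has_field_derivative_def has_derivative_within_alt
  proof (intro conjI allI impI)
    show "bounded_linear ((*) (g' z))" by (rule bounded_linear_mult_right)
    fix e :: real assume e: "e > 0"
    \<comment> \<open>The three error terms below add up to \<open>(2 * C + 2) * e'\<close>, that is
      \<open>e / 2\<close>.\<close>
    define e' where "e' = e / (4 * C + 4)"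
    have e': "e' > 0" using e C(1) by (simp add: e'_def)
    obtain k where k: "\<And>n z. n \<ge> k \<Longrightarrow> z \<in> X \<Longrightarrow> cmod (G' n z - g' z) \<le> e'"
      using unif[OF e'] by blast
    obtain d where d: "d > 0" "\<And>w. w \<in> X \<Longrightarrow> cmod (w - z) < d \<Longrightarrow>
        cmod (G k w - G k z - G' k z * (w - z)) \<le> e' * cmod (w - z)"
      using der[OF z, of k] e' unfolding has_field_derivative_def has_derivative_within_alt by blast
    have "cmod (g w - g z - g' z * (w - z)) \<le> e * cmod (w - z)" if w: "w \<in> X" "cmod (w - z) < d" for w
    proof -
      have 1: "cmod ((G n w - G k w) - (G n z - G k z)) \<le> 2 * e' * (C * cmod (w - z))" if "n \<ge> k" for n
      proof (rule C(2)[of "\<lambda>u. G n u - G k u" "\<lambda>u. G' n u - G' k u", OF _ z w(1)])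
        show "((\<lambda>u. G n u - G k u) has_field_derivative G' n u - G' k u) (at u within X)" if "u \<in> X" for u
          using der[OF that] by (intro DERIV_diff)
        show "cmod (G' n u - G' k u) \<le> 2 * e'" if "u \<in> X" for u
          using k[OF \<open>n \<ge> k\<close> that] k[OF order_refl that]
            norm_triangle_ineq4[of "G' n u - g' u" "G' k u - g' u"] by simp
      qed
      have "(\<lambda>n. cmod ((G n w - G k w) - (G n z - G k z))) \<longlonglongrightarrow> cmod ((g w - G k w) - (g z - G k z))"
        by (intro tendsto_intros lim z w)
      then have 2: "cmod ((g w - G k w) - (g z - G k z)) \<le> 2 * e' * (C * cmod (w - z))"
        by (rule LIMSEQ_le_const2) (use 1 in blast)
      have 3: "cmod ((G' k z - g' z) * (w - z)) \<le> e' * cmod (w - z)"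
        using k[OF order_refl z] by (simp add: norm_mult mult_right_mono)
      have "g w - g z - g' z * (w - z) = ((g w - G k w) - (g z - G k z))
          + (G k w - G k z - G' k z * (w - z)) + (G' k z - g' z) * (w - z)"
        by (simp add: algebra_simps)
      also have "cmod \<dots> \<le> 2 * e' * (C * cmod (w - z)) + e' * cmod (w - z) + e' * cmod (w - z)"
        by (intro norm_triangle_mono 2 3 d(2) w)
      also have "\<dots> = (2 * C + 2) * e' * cmod (w - z)" by (simp add: algebra_simps)
      also have "\<dots> \<le> e * cmod (w - z)"
      proof (rule mult_right_mono)
        have "(2 * C + 2) * e' = e / 2" using C(1) by (simp add: e'_def field_simps)
        then show "(2 * C + 2) * e' \<le> e" using e by simp
      qed simp
      finally show ?thesis .
    qed
    then show "\<exists>d>0. \<forall>y\<in>X. cmod (y - z) < d \<longrightarrow> cmod (g y - g z - g' z * (y - z)) \<le> e * cmod (y - z)"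
      using d(1) by blast
  qed
qed

text \<open>The norm dominates every derivative up to the factor \<open>M k\<close>, so all
  derivatives converge uniformly and their limits form a chain. The norm of the difference is then
  controlled through finite partial sums.\<close>

lemma Dspace_complete:
  assumes x: "\<And>n. x n \<in> Dspace X M"
    and cauchy: "\<And>e. e > 0 \<Longrightarrow> \<exists>k. \<forall>m\<ge>k. \<forall>n\<ge>k. normD X M (x m - x n) < e"
  shows "\<exists>l\<in>Dspace X M. (\<lambda>n. normD X M (x n - l)) \<longlonglongrightarrow> 0"
proof -
  define d where "d k n = nderivX X k (x n)" for k n
  have dd: "nderivX X k (x m - x n) z = d k m z - d k n z" if "z \<in> X" for k m n z
    unfolding d_def by (rule Dspace_diff(2)[OF x x that])
  have le: "cmod (d k m z - d k n z) \<le> M k * normD X M (x m - x n)" if "z \<in> X" for k m n z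
    using nderivX_le_normD[OF Dspace_diff(1)[OF x x] that, of k m n] dd[OF that] by simp
  \<comment> \<open>Off X nothing is known about this \<open>lim\<close>; the limit function
    \<open>f\<close> below is therefore cut to 0 there.\<close>
  define F where "F k z = lim (\<lambda>n. d k n z)" for k z
  have limF: "(\<lambda>n. d k n z) \<longlonglongrightarrow> F k z" if z: "z \<in> X" for k z
  proof -
    have "Cauchy (\<lambda>n. d k n z)"
    proof (rule metric_CauchyI)
      fix e :: real assume "e > 0"
      then obtain K where K: "\<forall>m\<ge>K. \<forall>n\<ge>K. normD X M (x m - x n) < e / M k"
        using cauchy[of "e / M k"] by auto
      have "dist (d k m z) (d k n z) < e" if "m \<ge> K" "n \<ge> K" for m n
      proof -
        have "normD X M (x m - x n) < e / M k" using K that by blast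
        then have "M k * normD X M (x m - x n) < e" using M_pos[of k] by (simp add: field_simps)
        then show ?thesis using le[OF z, of k m n] by (simp add: dist_norm)
      qed
      then show "\<exists>K. \<forall>m\<ge>K. \<forall>n\<ge>K. dist (d k m z) (d k n z) < e" by blast
    qed
    then show ?thesis unfolding F_def using Cauchy_convergent_iff convergent_LIMSEQ_iff by blast
  qed
  have unif: "cmod (d k n z - F k z) \<le> M k * e"
    if K: "\<forall>m\<ge>K. \<forall>n\<ge>K. normD X M (x m - x n) < e" and n: "n \<ge> K" and z: "z \<in> X" for k n z K e
  proof (rule LIMSEQ_le_const2)
    show "(\<lambda>m. cmod (d k n z - d k m z)) \<longlonglongrightarrow> cmod (d k n z - F k z)"
      by (intro tendsto_intros limF z)
    have "cmod (d k n z - d k m z) \<le> M k * e" if "m \<ge> K" for m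
      using le[OF z, of k n m] K n that by (meson M_pos less_imp_le mult_left_mono order_trans)
    then show "\<exists>N. \<forall>m\<ge>N. cmod (d k n z - d k m z) \<le> M k * e" by blast
  qed
  have chF: "deriv_chain F" unfolding deriv_chain_def
  proof (intro allI ballI)
    fix k z assume z: "z \<in> X"
    show "(F k has_field_derivative F (Suc k) z) (at z within X)"
    proof (rule deriv_of_uniform_limit[OF _ limF _ z])
      show "(d k n has_field_derivative d (Suc k) n u) (at u within X)" if "u \<in> X" for n u
        using Dspace_chain(1)[OF x] that unfolding d_def deriv_chain_def by blast
      fix e :: real assume "e > 0"
      then obtain K where "\<forall>m\<ge>K. \<forall>n\<ge>K. normD X M (x m - x n) < e / M (Suc k)"
        using cauchy[of "e / M (Suc k)"] by auto
      from unif[OF this, of _ _ "Suc k"] show "\<exists>K. \<forall>n\<ge>K. \<forall>z\<in>X. cmod (d (Suc k) n z - F (Suc k) z) \<le> e"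
        by (intro exI[of _ K]) (simp add: less_imp_neq[OF M_pos, symmetric])
    qed
  qed
  define f where "f z = (if z \<in> X then F 0 z else 0)" for z
  have close: "f - x n \<in> Dspace X M \<and> normD X M (f - x n) \<le> 2 * e"
    if K: "\<forall>m\<ge>K. \<forall>n\<ge>K. normD X M (x m - x n) < e" and n: "n \<ge> K" and e: "e > 0" for n K e
  proof -
    let ?G = "\<lambda>k z. F k z - d k n z"
    have ch: "deriv_chain ?G"
      using chF Dspace_chain(1)[OF x, of n] unfolding deriv_chain_def d_def by (auto intro: DERIV_diff)
    have partial: "(\<Sum>k<L. supX X (?G k) / M k) \<le> 2 * e" for L
    proof -
      \<comment> \<open>For a fixed number \<open>L\<close> of terms, \<open>F\<close> is replaced
        by the derivatives of a late \<open>x m\<close> at cost \<open>e'\<close> per term, at most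
        \<open>e\<close> in total. The other \<open>e\<close> bounds
        \<open>normD X M (x m - x n)\<close>, and the sum no longer depends on
        \<open>L\<close>.\<close>
      define e' where "e' = e / (real L + 1)"
      have e': "e' > 0" using e by (simp add: e'_def)
      obtain K' where K': "\<forall>m\<ge>K'. \<forall>n\<ge>K'. normD X M (x m - x n) < e'" using cauchy[OF e'] by blast
      define m where "m = max K K'"
      have sup_le: "supX X (?G k) / M k \<le> supX X (nderivX X k (x m - x n)) / M k + e'" for k
      proof -
        have "supX X (?G k) \<le> supX X (nderivX X k (x m - x n)) + M k * e'"
        proof (rule supX_least)
          fix z assume z: "z \<in> X"
          have "cmod (?G k z) \<le> cmod (d k m z - d k n z) + cmod (d k m z - F k z)"
            using norm_triangle_ineq4[of "d k m z - d k n z" "d k m z - F k z"] by simp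
          also have "cmod (d k m z - d k n z) \<le> supX X (nderivX X k (x m - x n))"
            using supX_upper[OF Dspace_chain(4)[OF Dspace_diff(1)[OF x x]] z, of k m n] dd[OF z] by simp
          also have "cmod (d k m z - F k z) \<le> M k * e'"
            by (rule unif[OF K' _ z]) (simp add: m_def)
          finally show "cmod (?G k z) \<le> supX X (nderivX X k (x m - x n)) + M k * e'" by (simp add: fun_diff_def)
        qed
        then have "supX X (?G k) / M k \<le> (supX X (nderivX X k (x m - x n)) + M k * e') / M k"
          by (intro divide_right_mono) (auto simp: less_imp_le)
        also have "\<dots> = supX X (nderivX X k (x m - x n)) / M k + e'"
          by (simp add: add_divide_distrib less_imp_neq[OF M_pos, symmetric])
        finally show ?thesis .
      qed
      have "(\<Sum>k<L. supX X (?G k) / M k) \<le> (\<Sum>k<L. supX X (nderivX X k (x m - x n)) / M k + e')"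
        by (rule sum_mono) (rule sup_le)
      also have "\<dots> = (\<Sum>k<L. supX X (nderivX X k (x m - x n)) / M k) + real L * e'"
        by (simp add: sum.distrib)
      also have "(\<Sum>k<L. supX X (nderivX X k (x m - x n)) / M k) \<le> normD X M (x m - x n)"
        by (rule sum_le_normD[OF Dspace_diff(1)[OF x x]])
      also have "normD X M (x m - x n) \<le> e" using K n by (simp add: m_def less_imp_le)
      also have "real L * e' \<le> e" using e by (simp add: e'_def field_simps)
      finally show ?thesis by simp
    qed
    have nn: "0 \<le> supX X (?G k) / M k" for k
      by (intro divide_nonneg_pos supX_nonneg deriv_chain_continuous[OF ch] M_pos)
    have sm: "summable (\<lambda>k. supX X (?G k) / M k)"
      using bounded_imp_summable[of "\<lambda>k. supX X (?G k) / M k" "2 * e"] nn partial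
      by (metis (no_types, lifting) lessThan_Suc_atMost)
    have 0: "?G 0 z = (f - x n) z" if "z \<in> X" for z
      using that by (simp add: f_def d_def nderivX_def)
    have off: "(f - x n) z = 0" if "z \<notin> X" for z
      using that Dspace_chain(3)[OF x] by (simp add: f_def)
    have "normD X M (f - x n) \<le> 2 * e"
      using suminf_le_const[OF sm partial] Dspace_chainI(2)[of _ "f - x n", OF ch 0 off sm] by simp
    then show ?thesis using Dspace_chainI(1)[of _ "f - x n", OF ch 0 off sm] by blast
  qed
  have "f \<in> Dspace X M"
  proof -
    obtain K where "\<forall>m\<ge>K. \<forall>n\<ge>K. normD X M (x m - x n) < 1" using cauchy[of 1] by auto
    then have "f - x K \<in> Dspace X M" using close[of K 1 K] by simp
    then have "(f - x K) + x K \<in> Dspace X M" using Dspace_add(1) x by blast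
    then show ?thesis by simp
  qed
  moreover have "(\<lambda>n. normD X M (x n - f)) \<longlonglongrightarrow> 0"
  proof (rule LIMSEQ_I)
    fix e :: real assume e: "e > 0"
    then obtain K where K: "\<forall>m\<ge>K. \<forall>n\<ge>K. normD X M (x m - x n) < e / 3" using cauchy[of "e / 3"] by auto
    have "norm (normD X M (x n - f) - 0) < e" if n: "n \<ge> K" for n
    proof -
      have c: "f - x n \<in> Dspace X M" "normD X M (f - x n) \<le> 2 * (e / 3)" using close[OF K n] e by auto
      have "x n - f = (\<lambda>z. (-1) * (f - x n) z)" by (simp add: fun_eq_iff)
      then have "normD X M (x n - f) = normD X M (f - x n)" using Dspace_scale(2)[OF c(1), of "-1"] by simp
      then show ?thesis using c(2) e normD_nonneg[OF c(1)] by simp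
    qed
    then show "\<exists>K. \<forall>n\<ge>K. norm (normD X M (x n - f) - 0) < e" by blast
  qed
  ultimately show ?thesis by blast
qed

text \<open>Definiteness of the norm rests on elements of \<open>Dspace\<close> being 0 off X, since
  the norm sees X only.\<close>

sublocale D: banach_on "\<lambda>c (f :: complex \<Rightarrow> complex) z. c * f z" "Dspace X M" "normD X M"
proof
  show "module.subspace (\<lambda>c (f :: complex \<Rightarrow> complex) z. c * f z) (Dspace X M)"
  proof -
    interpret vector_space "\<lambda>c (f :: complex \<Rightarrow> complex) z. c * f z"
      by unfold_locales (auto simp: fun_eq_iff algebra_simps)
    show ?thesis by (rule subspaceI) (auto simp: zero_in_Dspace Dspace_add Dspace_scale)
  qed
  show "f = 0" if f: "f \<in> Dspace X M" and 0: "normD X M f = 0" for f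
  proof
    fix z
    show "f z = 0 z" using cmod_le_normD[OF f, of z] Dspace_chain(3)[OF f, of z] 0 by (cases "z \<in> X") auto
  qed
qed (use Dspace_complete in \<open>auto simp: fun_eq_iff algebra_simps normD_nonneg Dspace_add Dspace_scale\<close>)

end

section \<open>The Taylor filtration\<close>

locale pointed_regular_weight = regular_weight +
  fixes x0 :: complex
  assumes x0: "x0 \<in> X"
begin

definition monomial :: "nat \<Rightarrow> complex \<Rightarrow> complex" where
  "monomial k z = (if z \<in> X then (z - x0) ^ k else 0)"

text \<open>Order of vanishing is encoded by growth because growth passes through composition with a
  Lipschitz map fixing \<open>x0\<close>, with no formula for higher derivatives of a composite. The
  description by derivatives is recovered in \<open>vanishing_iff\<close>.\<close>

definition vanishing :: "nat \<Rightarrow> (complex \<Rightarrow> complex) set" where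
  "vanishing k = {f \<in> Dspace X M. \<exists>C. \<forall>z\<in>X. cmod (f z) \<le> C * cmod (z - x0) ^ k}"

lemma vanishingE:
  assumes "f \<in> vanishing k"
  obtains C where "C \<ge> 0" "\<And>z. z \<in> X \<Longrightarrow> cmod (f z) \<le> C * cmod (z - x0) ^ k"
proof -
  obtain C where C: "\<And>z. z \<in> X \<Longrightarrow> cmod (f z) \<le> C * cmod (z - x0) ^ k"
    using assms unfolding vanishing_def by blast
  have "cmod (f z) \<le> \<bar>C\<bar> * cmod (z - x0) ^ k" if "z \<in> X" for z
    using C[OF that] mult_right_mono[OF abs_ge_self[of C], of "cmod (z - x0) ^ k"] by simp
  then show ?thesis using that[of "\<bar>C\<bar>"] by simp
qed

lemma vanishing_Dspace: "f \<in> vanishing k \<Longrightarrow> f \<in> Dspace X M"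
  by (simp add: vanishing_def)

lemma monomial_chain:
  defines "F \<equiv> \<lambda>k j z. if j \<le> k then fact k / fact (k - j) * (z - x0) ^ (k - j) else 0"
  shows "deriv_chain (F k)" "summable (\<lambda>n. supX X (F k n) / M n)" "F k 0 z = (z - x0) ^ k"
proof -
  show "deriv_chain (F k)" unfolding deriv_chain_def
  proof (intro allI ballI)
    fix j z assume "z \<in> X"
    show "(F k j has_field_derivative F k (Suc j) z) (at z within X)"
    proof (cases "j < k")
      case True
      then obtain i where i: "k - j = Suc i" "k - Suc j = i" by (metis Suc_diff_Suc)
      have "((\<lambda>z. fact k / fact (Suc i) * (z - x0) ^ Suc i) has_field_derivative fact k / fact i * (z - x0) ^ i) (at z within X)"
        by (rule derivative_eq_intros refl | simp)+ (simp add: field_simps flip: of_nat_Suc)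
      then show ?thesis using True i by (simp add: F_def)
    next
      case False
      then have "F k j = (\<lambda>z. if j = k then fact k else 0)" by (auto simp: F_def)
      then show ?thesis using False by (simp add: F_def)
    qed
  qed
  have "supX X (F k n) / M n = 0" if "n \<notin> {..k}" for n
  proof -
    have "F k n = (\<lambda>z. 0)" using that by (auto simp: F_def)
    then show ?thesis using X_nonempty by (simp add: supX_def)
  qed
  then show "summable (\<lambda>n. supX X (F k n) / M n)"
    by (intro summable_finite[of "{..k}"]) auto
  show "F k 0 z = (z - x0) ^ k" by (simp add: F_def)
qed

lemma monomial_Dspace: "monomial k \<in> Dspace X M"
  by (rule Dspace_chainI(1)[OF monomial_chain(1) _ _ monomial_chain(2)])
     (auto simp: monomial_def)

lemma nderivX_monomial: "nderivX X j (monomial k) x0 = (if j = k then fact k else 0)"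
  by (subst deriv_chain_nderivX[OF monomial_chain(1) _ x0]) (auto simp: monomial_def)

text \<open>Induction on the order, applied to the chain started at the first derivative. Its bound
  is used only at points within \<open>C * cmod (z - x0)\<close> of \<open>x0\<close>, so each
  integration adds one power of the distance and one factor \<open>C\<close>.\<close>

lemma taylor_bound:
  assumes "deriv_chain F" "\<And>i. i < k \<Longrightarrow> F i x0 = 0"
  shows "\<exists>B. \<forall>z\<in>X. cmod (F 0 z) \<le> B * cmod (z - x0) ^ k"
  using assms
proof (induction k arbitrary: F)
  case 0
  then show ?case
    using supX_upper[OF deriv_chain_continuous[OF 0(1)], of _ 0] by (intro exI[of _ "supX X (F 0)"]) auto
next
  case (Suc k)
  obtain C where C: "C > 0" "\<And>(f :: complex \<Rightarrow> complex) f' B z w.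
    (\<And>u. u \<in> X \<Longrightarrow> (f has_field_derivative f' u) (at u within X)) \<Longrightarrow> z \<in> X \<Longrightarrow> w \<in> X \<Longrightarrow>
    (\<And>u. u \<in> X \<Longrightarrow> cmod (u - z) \<le> C * cmod (w - z) \<Longrightarrow> cmod (f' u) \<le> B) \<Longrightarrow>
    cmod (f w - f z) \<le> B * (C * cmod (w - z))"
    using uniformly_regular_mean_value[OF reg] by blast
  have "deriv_chain (\<lambda>n. F (Suc n))" using Suc.prems by (simp add: deriv_chain_def)
  from Suc.IH[OF this] Suc.prems(2) obtain B where B: "\<And>z. z \<in> X \<Longrightarrow> cmod (F (Suc 0) z) \<le> B * cmod (z - x0) ^ k"
    by auto
  have "cmod (F 0 z) \<le> (\<bar>B\<bar> * C ^ k * C) * cmod (z - x0) ^ Suc k" if z: "z \<in> X" for z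
  proof -
    have "cmod (F 0 z - F 0 x0) \<le> (\<bar>B\<bar> * (C * cmod (z - x0)) ^ k) * (C * cmod (z - x0))"
    proof (rule C(2)[OF _ x0 z])
      show "(F 0 has_field_derivative F (Suc 0) u) (at u within X)" if "u \<in> X" for u
        using Suc.prems that by (auto simp: deriv_chain_def)
      fix u assume u: "u \<in> X" "cmod (u - x0) \<le> C * cmod (z - x0)"
      have "cmod (F (Suc 0) u) \<le> B * cmod (u - x0) ^ k" by (rule B[OF u(1)])
      also have "\<dots> \<le> \<bar>B\<bar> * cmod (u - x0) ^ k" by (intro mult_right_mono) auto
      also have "\<dots> \<le> \<bar>B\<bar> * (C * cmod (z - x0)) ^ k" by (intro mult_left_mono power_mono u) auto
      finally show "cmod (F (Suc 0) u) \<le> \<bar>B\<bar> * (C * cmod (z - x0)) ^ k" .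
    qed
    then show ?thesis using Suc.prems(2)[of 0] by (simp add: power_mult_distrib mult_ac)
  qed
  then show ?case by blast
qed

lemma taylor_vanishing:
  assumes "f \<in> Dspace X M" "\<And>i. i < k \<Longrightarrow> nderivX X i f x0 = 0"
  shows "f \<in> vanishing k"
  using taylor_bound[OF Dspace_chain(1)[OF assms(1)], of k] assms by (simp add: vanishing_def nderivX_def)

lemma vanishing_subspace: "D.subspace (vanishing k)"
proof (rule D.subspaceI)
  show "0 \<in> vanishing k" by (auto simp: vanishing_def intro!: exI[of _ 0])
  show "f + g \<in> vanishing k" if f: "f \<in> vanishing k" and g: "g \<in> vanishing k" for f g
  proof -
    obtain B where B: "\<And>z. z \<in> X \<Longrightarrow> cmod (f z) \<le> B * cmod (z - x0) ^ k" using vanishingE[OF f] by metis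
    obtain C where C: "\<And>z. z \<in> X \<Longrightarrow> cmod (g z) \<le> C * cmod (z - x0) ^ k" using vanishingE[OF g] by metis
    have "cmod ((f + g) z) \<le> (B + C) * cmod (z - x0) ^ k" if "z \<in> X" for z
      using norm_triangle_ineq[of "f z" "g z"] B[OF that] C[OF that] by (simp add: distrib_right)
    then show ?thesis using f g by (auto simp: vanishing_def)
  qed
  show "(\<lambda>z. c * f z) \<in> vanishing k" if f: "f \<in> vanishing k" for c f
  proof -
    obtain B where B: "\<And>z. z \<in> X \<Longrightarrow> cmod (f z) \<le> B * cmod (z - x0) ^ k" using vanishingE[OF f] by metis
    have "cmod (c * f z) \<le> (cmod c * B) * cmod (z - x0) ^ k" if "z \<in> X" for z
      using B[OF that] by (simp add: norm_mult mult.assoc mult_left_mono)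
    then show ?thesis using f by (auto simp: vanishing_def)
  qed
qed

lemmas vanishing_add = D.subspace_add[OF vanishing_subspace]
  and vanishing_diff = D.subspace_diff[OF vanishing_subspace]
  and vanishing_scale = D.subspace_scale[OF vanishing_subspace]
  and vanishing_0 = D.subspace_0[OF vanishing_subspace]

lemma vanishing_antimono:
  assumes "k \<le> l"
  shows "vanishing l \<subseteq> vanishing k"
proof
  fix f assume f: "f \<in> vanishing l"
  obtain B where B: "B \<ge> 0" "\<And>z. z \<in> X \<Longrightarrow> cmod (f z) \<le> B * cmod (z - x0) ^ l" using vanishingE[OF f] by metis
  have "bounded ((\<lambda>z. z - x0) ` X)"
    by (intro compact_imp_bounded compact_continuous_image compact_X continuous_intros)
  then obtain R where R: "R > 0" "\<And>z. z \<in> X \<Longrightarrow> cmod (z - x0) \<le> R" unfolding bounded_pos by auto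
  have "cmod (f z) \<le> (B * R ^ (l - k)) * cmod (z - x0) ^ k" if z: "z \<in> X" for z
  proof -
    have "cmod (z - x0) ^ l = cmod (z - x0) ^ (l - k) * cmod (z - x0) ^ k"
      using assms by (simp flip: power_add)
    also have "\<dots> \<le> R ^ (l - k) * cmod (z - x0) ^ k" by (intro mult_right_mono power_mono R z) auto
    finally have "B * cmod (z - x0) ^ l \<le> B * (R ^ (l - k) * cmod (z - x0) ^ k)"
      using B(1) by (rule mult_left_mono)
    then show ?thesis using B(2)[OF z] by (simp add: mult.assoc)
  qed
  then show "f \<in> vanishing k" using f by (auto simp: vanishing_def)
qed

lemma monomial_vanishing: "monomial k \<in> vanishing k"
  using monomial_Dspace by (auto simp: vanishing_def monomial_def norm_power intro!: exI[of _ 1])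

text \<open>As \<open>x0\<close> is a limit point of X, there are points other than
  \<open>x0\<close> so close to it that the power \<open>k\<close> beats any multiple of the power
  \<open>k + 1\<close>.\<close>

lemma scaled_monomial_not_vanishing:
  assumes "(\<lambda>z. a * monomial k z) \<in> vanishing (Suc k)"
  shows "a = 0"
proof (rule ccontr)
  assume a: "a \<noteq> 0"
  obtain B where B: "B \<ge> 0" "\<And>z. z \<in> X \<Longrightarrow> cmod (a * monomial k z) \<le> B * cmod (z - x0) ^ Suc k"
    using vanishingE[OF assms] by metis
  have pos: "cmod a / (B + 1) > 0" using a B by simp
  obtain z where z: "z \<in> X" "z \<noteq> x0" "dist z x0 < cmod a / (B + 1)"
    using limpt_X[OF x0] pos unfolding islimpt_approachable by blast
  have "cmod a * cmod (z - x0) ^ k \<le> (B * cmod (z - x0)) * cmod (z - x0) ^ k"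
    using B(2)[OF z(1)] z(1) by (simp add: monomial_def norm_mult norm_power mult_ac)
  then have "cmod a \<le> B * cmod (z - x0)" using z(2) by simp
  also have "\<dots> \<le> (B + 1) * cmod (z - x0)" by (intro mult_right_mono) auto
  also have "\<dots> < cmod a" using z(3) B(1) by (simp add: dist_norm field_simps)
  finally show False by simp
qed

lemma vanishing_split:
  assumes f: "f \<in> Dspace X M" and 0: "\<And>i. i < k \<Longrightarrow> nderivX X i f x0 = 0"
  shows "f - (\<lambda>z. (nderivX X k f x0 / fact k) * monomial k z) \<in> vanishing (Suc k)"
proof (rule taylor_vanishing)
  let ?a = "nderivX X k f x0 / fact k"
  note m = Dspace_scale(1)[OF monomial_Dspace, of ?a k]
  show "f - (\<lambda>z. ?a * monomial k z) \<in> Dspace X M" by (rule Dspace_diff(1)[OF f m])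
  fix i assume "i < Suc k"
  then show "nderivX X i (f - (\<lambda>z. ?a * monomial k z)) x0 = 0"
    unfolding Dspace_diff(2)[OF f m x0] Dspace_scale(3)[OF monomial_Dspace x0] nderivX_monomial
    using 0[of i] by auto
qed

text \<open>Once the lower coefficients are 0, both \<open>f\<close> and \<open>f\<close> minus its
  leading monomial are of order \<open>i + 1\<close>. So the leading term is of that order too,
  which forces its coefficient to be 0.\<close>

lemma vanishing_nderivX:
  assumes f: "f \<in> vanishing k" and "i < k"
  shows "nderivX X i f x0 = 0"
  using assms(2)
proof (induction i rule: less_induct)
  case (less i)
  let ?m = "\<lambda>z. (nderivX X i f x0 / fact i) * monomial i z"
  have "f - ?m \<in> vanishing (Suc i)"
    using less by (intro vanishing_split vanishing_Dspace[OF f]) auto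
  moreover have "f \<in> vanishing (Suc i)" using f vanishing_antimono less.prems by (meson Suc_leI subsetD)
  ultimately have "f - (f - ?m) \<in> vanishing (Suc i)" by (rule vanishing_diff[rotated])
  then have "?m \<in> vanishing (Suc i)" by simp
  then show ?case using scaled_monomial_not_vanishing[of "nderivX X i f x0 / fact i"] by simp
qed

lemma vanishing_iff: "f \<in> vanishing k \<longleftrightarrow> f \<in> Dspace X M \<and> (\<forall>i<k. nderivX X i f x0 = 0)"
  using vanishing_nderivX taylor_vanishing vanishing_Dspace by blast

lemma vanishing_leading:
  assumes "f \<in> vanishing k"
  obtains a where "f - (\<lambda>z. a * monomial k z) \<in> vanishing (Suc k)"
  using vanishing_split[of f k] assms vanishing_iff by blast

text \<open>Membership is the vanishing of finitely many derivatives at \<open>x0\<close>, each a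
  continuous functional for \<open>normD\<close>.\<close>

lemma vanishing_closed: "D.closed_sub (vanishing k)"
  unfolding D.closed_sub_def
proof (intro conjI allI impI)
  show "D.subspace (vanishing k)" by (rule vanishing_subspace)
  show "vanishing k \<subseteq> Dspace X M" using vanishing_Dspace by blast
  fix x l assume x: "\<forall>n. x n \<in> vanishing k" and l: "l \<in> Dspace X M" "(\<lambda>n::nat. normD X M (x n - l)) \<longlonglongrightarrow> 0"
  have "nderivX X i l x0 = 0" if i: "i < k" for i
  proof -
    have "cmod (nderivX X i l x0) \<le> M i * normD X M (x n - l)" for n
    proof -
      have xn: "x n \<in> Dspace X M" "nderivX X i (x n) x0 = 0" using x i by (auto simp: vanishing_iff)
      have "cmod (nderivX X i (x n - l) x0) \<le> M i * normD X M (x n - l)"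
        by (rule nderivX_le_normD[OF Dspace_diff(1)[OF xn(1) l(1)] x0])
      then show ?thesis by (simp add: Dspace_diff(2)[OF xn(1) l(1) x0] xn(2))
    qed
    moreover have "(\<lambda>n. M i * normD X M (x n - l)) \<longlonglongrightarrow> M i * 0" by (intro tendsto_intros l)
    ultimately have "cmod (nderivX X i l x0) \<le> M i * 0" by (intro LIMSEQ_le_const) auto
    then show ?thesis by simp
  qed
  then show "l \<in> vanishing k" using l(1) by (simp add: vanishing_iff)
qed

lemma vanishing_strict: "vanishing (Suc k) \<subset> vanishing k"
  using vanishing_antimono[of k "Suc k"] monomial_vanishing[of k] scaled_monomial_not_vanishing[of 1 k] by auto

end

section \<open>Riesz operators on D(X,M)\<close>

context regular_weight
begin

lemma lin_op_iff: "lin_op X M A \<longleftrightarrow> D.lin_on A"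
  by (simp add: lin_op_def D.lin_on_def plus_fun_def)

lemma bounded_op_iff: "bounded_op X M A \<longleftrightarrow> D.bounded_on A"
  by (simp add: bounded_op_def D.bounded_on_def lin_op_iff)

lemma compact_op_iff: "compact_op X M A \<longleftrightarrow> D.compact_on A"
  by (simp add: compact_op_def D.compact_on_def lin_op_iff fun_diff_def)

lemma shift_op_eq: "shift_op T \<mu> = (\<lambda>f. T f - (\<lambda>z. \<mu> * f z))"
  by (simp add: shift_op_def fun_diff_def)

text \<open>Boundedness of \<open>A\<close> bounds the set whose \<open>Sup\<close> is
  \<open>op_norm\<close>, so the supremum is a genuine upper bound; the rest is homogeneity.\<close>

lemma normD_le_op_norm:
  assumes A: "D.bounded_on A" and f: "f \<in> Dspace X M"
  shows "normD X M (A f) \<le> op_norm X M A * normD X M f"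
proof (cases "f = 0")
  case True
  then have "A f = 0" using A D.lin_on_0[of A] unfolding D.bounded_on_def by metis
  then show ?thesis using True D.N_0 by (metis mult_zero_right order_refl)
next
  case False
  then have pos: "normD X M f > 0" using D.N_eq_0[OF f] normD_nonneg[OF f] by fastforce
  have lin: "D.lin_on A" using A by (simp add: D.bounded_on_def)
  obtain C where C: "C > 0" "\<And>x. x \<in> Dspace X M \<Longrightarrow> normD X M (A x) \<le> C * normD X M x"
    using D.bounded_onE[OF A] by blast
  have bdd: "bdd_above {normD X M (A f) | f. f \<in> Dspace X M \<and> normD X M f \<le> 1}"
  proof (rule bdd_aboveI)
    fix y assume "y \<in> {normD X M (A f) | f. f \<in> Dspace X M \<and> normD X M f \<le> 1}"
    then obtain h where h: "y = normD X M (A h)" "h \<in> Dspace X M" "normD X M h \<le> 1" by blast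
    have "C * normD X M h \<le> C * 1" using C(1) by (intro mult_left_mono h(3)) simp
    then show "y \<le> C" using C(2)[OF h(2)] h(1) by linarith
  qed
  define c where "c = complex_of_real (1 / normD X M f)"
  have c: "cmod c = 1 / normD X M f" using pos by (simp add: c_def norm_divide)
  have "normD X M (A (\<lambda>z. c * f z)) \<le> op_norm X M A"
    unfolding op_norm_def
    by (rule cSup_upper[OF _ bdd]) (use f pos c in \<open>auto simp: Dspace_scale\<close>)
  also have "normD X M (A (\<lambda>z. c * f z)) = normD X M (A f) / normD X M f"
    using D.lin_on_scale[OF lin f] D.lin_on_V[OF lin f] c by (simp add: Dspace_scale)
  finally show ?thesis using pos by (simp add: field_simps)
qed

text \<open>Eventually the \<open>n\<close>-th root of the essential norm is below
  \<open>c / 8\<close>, and \<open>(c / 8) ^ n \<le> c ^ n / 8\<close> for \<open>n \<ge> 1\<close>.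
  A compact operator nearly attaining the infimum then serves.\<close>

lemma riesz_near_compact:
  assumes "riesz_op X M T" "c > 0"
  shows "D.near_compact T c"
proof -
  have T: "D.bounded_on T" and lim: "(\<lambda>n. root n (ess_norm X M (T ^^ n))) \<longlonglongrightarrow> 0"
    using assms(1) by (auto simp: riesz_op_def bounded_op_iff)
  have "c / 8 > 0" using assms(2) by simp
  then obtain n where n: "n \<ge> 1" "root n (ess_norm X M (T ^^ n)) < c / 8"
    using tendsto_0D[OF lim] by (metis nat_le_linear)
  have "ess_norm X M (T ^^ n) < (c / 8) ^ n"
  proof -
    have "root n (ess_norm X M (T ^^ n)) < root n ((c / 8) ^ n)"
      using n assms(2) by (simp add: real_root_power_cancel)
    then show ?thesis using n(1) by simp
  qed
  \<comment> \<open>The zero operator shows that the infimum in \<open>ess_norm\<close> is over a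
    nonempty set.\<close>
  moreover have "D.compact_on (\<lambda>f. 0)"
    unfolding D.compact_on_def
  proof (intro conjI allI impI)
    show "D.lin_on (\<lambda>f. 0)" by (auto simp: D.lin_on_def fun_eq_iff)
    show "\<exists>r g. strict_mono (r::nat \<Rightarrow> nat) \<and> g \<in> Dspace X M \<and> (\<lambda>n. normD X M (0 - g)) \<longlonglongrightarrow> 0"
      by (intro exI[of _ id] exI[of _ "0 :: complex \<Rightarrow> complex"]) (auto simp: strict_mono_def)
  qed
  then have "{op_norm X M (\<lambda>f z. (T ^^ n) f z - KK f z) | KK. compact_op X M KK} \<noteq> {}"
    unfolding compact_op_iff by blast
  ultimately obtain K where K: "D.compact_on K" "op_norm X M (\<lambda>f z. (T ^^ n) f z - K f z) < (c / 8) ^ n"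
    unfolding ess_norm_def compact_op_iff using cInf_lessD by (smt (verit) mem_Collect_eq)
  have Kb: "D.bounded_on K" by (rule D.compact_on_bounded[OF K(1)])
  have Tb: "D.bounded_on (T ^^ n)" by (rule D.bounded_on_pow[OF T])
  obtain C1 where C1: "\<And>x. x \<in> Dspace X M \<Longrightarrow> normD X M (K x) \<le> C1 * normD X M x"
    using D.bounded_onE[OF Kb] by blast
  obtain C2 where C2: "\<And>x. x \<in> Dspace X M \<Longrightarrow> normD X M ((T ^^ n) x) \<le> C2 * normD X M x"
    using D.bounded_onE[OF Tb] by blast
  have lin: "D.lin_on K" "D.lin_on (T ^^ n)" using Kb Tb by (auto simp: D.bounded_on_def)
  let ?R = "\<lambda>f. (T ^^ n) f - K f"
  have "D.lin_on ?R" using lin by (auto simp: D.lin_on_def fun_eq_iff algebra_simps)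
  moreover have "normD X M (?R f) \<le> (C2 + C1) * normD X M f" if f: "f \<in> Dspace X M" for f
    using D.N_diff_le[OF D.lin_on_V[OF lin(2) f] D.lin_on_V[OF lin(1) f]] C1[OF f] C2[OF f]
    by (simp add: distrib_right)
  ultimately have R: "D.bounded_on ?R" unfolding D.bounded_on_def by blast
  have "(c / 8) ^ n \<le> c ^ n / 8"
  proof -
    have "(8::real) ^ 1 \<le> 8 ^ n" using n(1) by (intro power_increasing) auto
    then show ?thesis unfolding power_divide using assms(2) by (intro divide_left_mono) auto
  qed
  have "normD X M (?R f) \<le> c ^ n / 8 * normD X M f" if f: "f \<in> Dspace X M" for f
  proof -
    have "normD X M (?R f) \<le> op_norm X M ?R * normD X M f" by (rule normD_le_op_norm[OF R f])
    also have "\<dots> \<le> c ^ n / 8 * normD X M f"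
      using K(2) \<open>(c / 8) ^ n \<le> c ^ n / 8\<close> normD_nonneg[OF f]
      by (intro mult_right_mono) (auto simp: fun_diff_def)
    finally show ?thesis .
  qed
  then show ?thesis unfolding D.near_compact_def using n(1) K(1) by blast
qed

lemma not_in_spectrum:
  assumes "riesz_op X M T" "\<mu> \<noteq> 0"
    and "\<And>f. f \<in> Dspace X M \<Longrightarrow> T f - (\<lambda>z. \<mu> * f z) = 0 \<Longrightarrow> f = 0"
  shows "\<mu> \<notin> spectrum_op X M T"
proof -
  have T: "D.bounded_on T" using assms(1) by (auto simp: riesz_op_def bounded_op_iff)
  have nc: "D.near_compact T (cmod \<mu>)" using riesz_near_compact[OF assms(1)] assms(2) by simp
  from D.shift_invertible[OF T nc assms(2,3)] show ?thesis
    unfolding spectrum_op_def invertible_op_def shift_op_eq bounded_op_iff by simp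
qed

end

section \<open>The spectrum of a Riesz composition operator\<close>

locale riesz_composition = pointed_regular_weight +
  fixes \<phi> :: "complex \<Rightarrow> complex" and T :: opr
  assumes self_map: "z \<in> X \<Longrightarrow> \<phi> z \<in> X"
    and T_def: "T = comp_op X \<phi>"
    and riesz: "riesz_op X M T"
    and fixpoint: "\<phi> x0 = x0"
begin

definition lam :: complex where
  "lam = derivX X \<phi> x0"

lemma T_lin: "D.lin_on T"
  using riesz by (auto simp: riesz_op_def bounded_op_iff D.bounded_on_def)

lemma T_Dspace: "f \<in> Dspace X M \<Longrightarrow> T f \<in> Dspace X M"
  using D.lin_on_V[OF T_lin] .

lemma T_apply: "z \<in> X \<Longrightarrow> T f z = f (\<phi> z)"
  by (simp add: T_def comp_op_def)

lemma iter_self_map: "z \<in> X \<Longrightarrow> (\<phi> ^^ n) z \<in> X"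
  by (induction n) (auto intro: self_map)

lemma T_iter_apply: "z \<in> X \<Longrightarrow> (T ^^ n) f z = f ((\<phi> ^^ n) z)"
proof (induction n arbitrary: z)
  case (Suc n)
  have "(T ^^ Suc n) f z = (T ^^ n) f (\<phi> z)" using Suc.prems by (simp add: T_apply)
  also have "\<dots> = f ((\<phi> ^^ n) (\<phi> z))" using Suc self_map by blast
  finally show ?case by (simp add: funpow_swap1)
qed simp

text \<open>On X the map \<open>\<phi>\<close> is the image of the coordinate function under
  \<open>T\<close>, shifted by \<open>x0\<close>; its smoothness is inherited from
  \<open>T (monomial 1)\<close> lying in D(X,M).\<close>

lemma phi_deriv: "(\<phi> has_field_derivative nderivX X 1 (T (monomial 1)) x0) (at x0 within X)"
proof -
  have "(nderivX X 0 (T (monomial 1)) has_field_derivative nderivX X 1 (T (monomial 1)) x0) (at x0 within X)"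
    using Dspace_chain(1)[OF T_Dspace[OF monomial_Dspace]] x0 unfolding deriv_chain_def by auto
  then have "((\<lambda>z. T (monomial 1) z + x0) has_field_derivative nderivX X 1 (T (monomial 1)) x0) (at x0 within X)"
    by (auto simp: nderivX_def intro!: derivative_eq_intros)
  then show ?thesis
    by (rule has_field_derivative_transform_within[where d = 1])
       (auto simp: x0 T_apply monomial_def self_map)
qed

lemma lam_eq: "lam = nderivX X 1 (T (monomial 1)) x0"
  unfolding lam_def by (rule derivX_eq[OF x0 phi_deriv])

lemma phi_lipschitz: "\<exists>L\<ge>0. \<forall>z\<in>X. cmod (\<phi> z - x0) \<le> L * cmod (z - x0)"
proof -
  have "nderivX X i (T (monomial 1)) x0 = 0" if "i < 1" for i
    using that x0 fixpoint by (simp add: nderivX_def T_apply monomial_def)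
  then have "T (monomial 1) \<in> vanishing 1"
    using taylor_vanishing[OF T_Dspace[OF monomial_Dspace]] by blast
  then obtain L where L: "L \<ge> 0" "\<And>z. z \<in> X \<Longrightarrow> cmod (T (monomial 1) z) \<le> L * cmod (z - x0) ^ 1"
    using vanishingE by metis
  have "cmod (\<phi> z - x0) \<le> L * cmod (z - x0)" if "z \<in> X" for z
    using L(2)[OF that] that self_map by (simp add: T_apply monomial_def)
  then show ?thesis using L(1) by blast
qed

lemma phi_second_order: "\<exists>B. \<forall>z\<in>X. cmod (\<phi> z - x0 - lam * (z - x0)) \<le> B * cmod (z - x0) ^ 2"
proof -
  have "T (monomial 1) - (\<lambda>z. (nderivX X 1 (T (monomial 1)) x0 / fact 1) * monomial 1 z) \<in> vanishing (Suc 1)"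
    by (rule vanishing_split[OF T_Dspace[OF monomial_Dspace]])
       (use x0 fixpoint in \<open>simp add: nderivX_def T_apply monomial_def\<close>)
  then have "T (monomial 1) - (\<lambda>z. lam * monomial 1 z) \<in> vanishing 2"
    by (simp add: lam_eq numeral_2_eq_2)
  then obtain B where B: "\<And>z. z \<in> X \<Longrightarrow> cmod ((T (monomial 1) - (\<lambda>z. lam * monomial 1 z)) z) \<le> B * cmod (z - x0) ^ 2"
    using vanishingE by metis
  have "cmod (\<phi> z - x0 - lam * (z - x0)) \<le> B * cmod (z - x0) ^ 2" if "z \<in> X" for z
    using B[OF that] that self_map by (simp add: T_apply monomial_def)
  then show ?thesis by blast
qed

lemma T_vanishing:
  assumes f: "f \<in> vanishing k"
  shows "T f \<in> vanishing k"
proof -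
  obtain L where L: "L \<ge> 0" "\<And>z. z \<in> X \<Longrightarrow> cmod (\<phi> z - x0) \<le> L * cmod (z - x0)" using phi_lipschitz by blast
  obtain C where C: "C \<ge> 0" "\<And>z. z \<in> X \<Longrightarrow> cmod (f z) \<le> C * cmod (z - x0) ^ k" using vanishingE[OF f] by metis
  have "cmod (T f z) \<le> (C * L ^ k) * cmod (z - x0) ^ k" if z: "z \<in> X" for z
  proof -
    have "cmod (T f z) \<le> C * cmod (\<phi> z - x0) ^ k" using C(2)[OF self_map[OF z]] z by (simp add: T_apply)
    also have "\<dots> \<le> C * (L * cmod (z - x0)) ^ k" by (intro mult_left_mono power_mono L C z) auto
    finally show ?thesis by (simp add: power_mult_distrib mult.assoc)
  qed
  then show ?thesis using T_Dspace[OF vanishing_Dspace[OF f]] by (auto simp: vanishing_def)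
qed

text \<open>With \<open>u = \<phi> z - x0\<close> and \<open>v = lam * (z - x0)\<close>, the
  difference of the powers \<open>k + 1\<close> is
  \<open>u * (u ^ k - v ^ k) + (u - v) * v ^ k\<close>. The factor \<open>u\<close> adds one order
  to the inductive bound, and \<open>u - v\<close> is of second order.\<close>

lemma phi_power:
  "\<exists>B. \<forall>z\<in>X. cmod ((\<phi> z - x0) ^ k - (lam * (z - x0)) ^ k) \<le> B * cmod (z - x0) ^ Suc k"
proof (induction k)
  case 0
  show ?case by (auto intro!: exI[of _ 0])
next
  case (Suc k)
  obtain L where L: "L \<ge> 0" "\<And>z. z \<in> X \<Longrightarrow> cmod (\<phi> z - x0) \<le> L * cmod (z - x0)" using phi_lipschitz by blast
  obtain A where A: "\<And>z. z \<in> X \<Longrightarrow> cmod (\<phi> z - x0 - lam * (z - x0)) \<le> A * cmod (z - x0) ^ 2"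
    using phi_second_order by blast
  obtain B where B: "\<And>z. z \<in> X \<Longrightarrow> cmod ((\<phi> z - x0) ^ k - (lam * (z - x0)) ^ k) \<le> B * cmod (z - x0) ^ Suc k"
    using Suc by blast
  have "cmod ((\<phi> z - x0) ^ Suc k - (lam * (z - x0)) ^ Suc k) \<le> (L * B + A * cmod lam ^ k) * cmod (z - x0) ^ Suc (Suc k)"
    if z: "z \<in> X" for z
  proof -
    define u v t where "u = \<phi> z - x0" and "v = lam * (z - x0)" and "t = cmod (z - x0)"
    have "u ^ Suc k - v ^ Suc k = u * (u ^ k - v ^ k) + (u - v) * v ^ k" by (simp add: algebra_simps)
    then have "cmod (u ^ Suc k - v ^ Suc k) \<le> cmod u * cmod (u ^ k - v ^ k) + cmod (u - v) * cmod v ^ k"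
      using norm_triangle_ineq[of "u * (u ^ k - v ^ k)" "(u - v) * v ^ k"] by (simp add: norm_mult norm_power)
    also have "\<dots> \<le> (L * t) * (B * t ^ Suc k) + (A * t ^ 2) * cmod v ^ k"
      unfolding u_def v_def t_def using L B[OF z] A[OF z] z by (intro add_mono mult_mono mult_right_mono) auto
    also have "cmod v ^ k = cmod lam ^ k * t ^ k" by (simp add: v_def t_def norm_mult power_mult_distrib)
    finally show ?thesis unfolding u_def v_def t_def by (simp add: algebra_simps power2_eq_square)
  qed
  then show ?case by blast
qed

text \<open>Split \<open>f\<close> into a multiple of \<open>monomial k\<close> and a remainder of
  order \<open>k + 1\<close>. The monomial is handled by \<open>phi_power\<close>, and
  \<open>T\<close> preserves the order of the remainder.\<close>

lemma T_diagonal: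
  assumes f: "f \<in> vanishing k"
  shows "T f - (\<lambda>z. lam ^ k * f z) \<in> vanishing (Suc k)"
proof -
  obtain a where a: "f - (\<lambda>z. a * monomial k z) \<in> vanishing (Suc k)" using vanishing_leading[OF f] .
  define h where "h = f - (\<lambda>z. a * monomial k z)"
  define g where "g = T (monomial k) - (\<lambda>z. lam ^ k * monomial k z)"
  have "g \<in> vanishing (Suc k)"
  proof -
    obtain B where B: "\<And>z. z \<in> X \<Longrightarrow> cmod ((\<phi> z - x0) ^ k - (lam * (z - x0)) ^ k) \<le> B * cmod (z - x0) ^ Suc k"
      using phi_power by blast
    have "cmod (g z) \<le> B * cmod (z - x0) ^ Suc k" if "z \<in> X" for z
      using B[OF that] that self_map by (simp add: g_def T_apply monomial_def power_mult_distrib)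
    moreover have "g \<in> Dspace X M" unfolding g_def
      by (intro Dspace_diff T_Dspace Dspace_scale monomial_Dspace)
    ultimately show ?thesis by (auto simp: vanishing_def)
  qed
  moreover have h: "h \<in> vanishing (Suc k)" using a by (simp add: h_def)
  ultimately have "T h + (\<lambda>z. a * g z) - (\<lambda>z. lam ^ k * h z) \<in> vanishing (Suc k)"
    by (intro vanishing_diff vanishing_add vanishing_scale T_vanishing)
  also have "T h + (\<lambda>z. a * g z) - (\<lambda>z. lam ^ k * h z) = T f - (\<lambda>z. lam ^ k * f z)"
    by (rule ext) (simp add: h_def g_def T_def comp_op_def algebra_simps)
  finally show ?thesis .
qed

text \<open>If \<open>cmod lam \<ge> 1\<close>, every diagonal entry \<open>lam ^ k\<close> has
  modulus at least 1, and the filtration contradicts \<open>no_expanding_chain\<close> with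
  \<open>c = 1\<close>.\<close>

lemma lam_less_1: "cmod lam < 1"
proof (rule ccontr)
  assume "\<not> ?thesis"
  then have "cmod (lam ^ k) \<ge> 1" for k by (simp add: norm_power one_le_power)
  then show False
    using D.no_expanding_chain[of T 1 vanishing "\<lambda>k. lam ^ k"] T_lin riesz_near_compact[OF riesz]
      vanishing_closed vanishing_strict T_vanishing T_diagonal by auto
qed

section \<open>Attraction of every orbit to the fixed point\<close>

text \<open>Half of the gap \<open>1 - cmod lam\<close> is spent on the error of linearisation,
  which leaves the contraction ratio \<open>r\<close> below 1. The disc is mapped into itself, so
  the estimate iterates.\<close>

lemma attracting:
  obtains r d where "0 \<le> r" "r < 1" "d > 0"
    "\<And>w n. w \<in> X \<Longrightarrow> cmod (w - x0) < d \<Longrightarrow> cmod ((\<phi> ^^ n) w - x0) \<le> r ^ n * cmod (w - x0)"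
proof -
  define r where "r = (cmod lam + 1) / 2"
  have r: "0 \<le> r" "r < 1" "cmod lam + (1 - cmod lam) / 2 = r" "(1 - cmod lam) / 2 > 0"
    using lam_less_1 by (auto simp: r_def field_simps add_nonneg_nonneg)
  obtain d where d: "d > 0" "\<And>w. w \<in> X \<Longrightarrow> cmod (w - x0) < d \<Longrightarrow> cmod (\<phi> w - x0) \<le> r * cmod (w - x0)"
    using has_field_derivative_local_bound[OF phi_deriv[folded lam_eq] r(4)] fixpoint r(3) by auto
  have "cmod ((\<phi> ^^ n) w - x0) \<le> r ^ n * cmod (w - x0)" if w: "w \<in> X" "cmod (w - x0) < d" for w n
  proof (induction n)
    case (Suc n)
    have "r ^ n * cmod (w - x0) \<le> cmod (w - x0)" using r by (simp add: mult_left_le_one_le power_le_one)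
    then have "cmod ((\<phi> ^^ n) w - x0) < d" using Suc w by simp
    then have "cmod (\<phi> ((\<phi> ^^ n) w) - x0) \<le> r * cmod ((\<phi> ^^ n) w - x0)" using d(2) iter_self_map w by blast
    also have "\<dots> \<le> r * (r ^ n * cmod (w - x0))" using Suc r by (intro mult_left_mono)
    finally show ?case by (simp add: mult.assoc)
  qed simp
  then show ?thesis using that r d(1) by blast
qed

text \<open>On X, \<open>(T ^^ n) (monomial 1)\<close> is the \<open>n\<close>-th iterate of
  \<open>\<phi>\<close> minus \<open>x0\<close>. Its norm is bounded in \<open>n\<close> by
  \<open>orbit_bounded\<close> with the sup norm as the weaker seminorm, and \<open>M 1 * C\<close>
  then bounds the first derivatives of all iterates.\<close>

lemma iterates_equi_lipschitz:
  "\<exists>K>0. \<forall>n. \<forall>z\<in>X. \<forall>w\<in>X. cmod ((\<phi> ^^ n) z - (\<phi> ^^ n) w) \<le> K * cmod (z - w)"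
proof -
  have cont: "continuous_on X f" if "f \<in> Dspace X M" for f
    using Dspace_chain(4)[OF that, of 0] by (simp add: nderivX_def)
  have "\<exists>C. \<forall>n. normD X M ((T ^^ n) (monomial 1)) \<le> C"
  proof (rule D.orbit_bounded[where p = "supX X", OF T_lin riesz_near_compact[OF riesz]])
    fix f g :: "complex \<Rightarrow> complex" and c :: complex
    assume f: "f \<in> Dspace X M"
    show "supX X f \<le> normD X M f" by (intro supX_least cmod_le_normD f)
    show "0 \<le> supX X f" by (intro supX_nonneg cont f)
    show "f = 0" if "supX X f = 0"
    proof
      fix z show "f z = 0 z"
        using supX_upper[OF cont[OF f], of z] Dspace_chain(3)[OF f, of z] that by (cases "z \<in> X") auto
    qed
    show "supX X (\<lambda>z. c * f z) = cmod c * supX X f"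
      using supX_scale[OF cont[OF f]] .
    show "supX X (T f) \<le> supX X f"
      by (intro supX_least) (simp add: T_apply supX_upper[OF cont[OF f]] self_map)
    assume g: "g \<in> Dspace X M"
    show "supX X (f + g) \<le> supX X f + supX X g"
      using supX_upper[OF cont[OF f]] supX_upper[OF cont[OF g]]
      by (intro supX_least) (simp, meson add_mono norm_triangle_le)
  qed (use monomial_Dspace in auto)
  then obtain C where C: "\<And>n. normD X M ((T ^^ n) (monomial 1)) \<le> C" by blast
  obtain G where G: "G > 0" "\<And>(f :: complex \<Rightarrow> complex) f' B z w.
    (\<And>u. u \<in> X \<Longrightarrow> (f has_field_derivative f' u) (at u within X)) \<Longrightarrow> z \<in> X \<Longrightarrow> w \<in> X \<Longrightarrow>
    (\<And>u. u \<in> X \<Longrightarrow> cmod (u - z) \<le> G * cmod (w - z) \<Longrightarrow> cmod (f' u) \<le> B) \<Longrightarrow>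
    cmod (f w - f z) \<le> B * (G * cmod (w - z))"
    using uniformly_regular_mean_value[OF reg] by blast
  have "cmod ((\<phi> ^^ n) z - (\<phi> ^^ n) w) \<le> (\<bar>M 1 * C\<bar> * G + 1) * cmod (z - w)" if zw: "z \<in> X" "w \<in> X" for n z w
  proof -
    define f where "f = (T ^^ n) (monomial 1)"
    have f: "f \<in> Dspace X M" unfolding f_def
      using D.lin_on_V[OF D.lin_on_pow[OF T_lin]] monomial_Dspace by blast
    have "cmod (f z - f w) \<le> \<bar>M 1 * C\<bar> * (G * cmod (z - w))"
    proof (rule G(2)[OF _ zw(2,1)])
      show "(f has_field_derivative nderivX X 1 f u) (at u within X)" if "u \<in> X" for u
        using Dspace_chain(1)[OF f] that unfolding deriv_chain_def
        by (metis Dspace_chain(5)[OF f] One_nat_def)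
      show "cmod (nderivX X 1 f u) \<le> \<bar>M 1 * C\<bar>" if "u \<in> X" for u
      proof -
        have "cmod (nderivX X 1 f u) \<le> M 1 * normD X M f" by (rule nderivX_le_normD[OF f that])
        also have "\<dots> \<le> M 1 * C" using C[of n] by (intro mult_left_mono) (auto simp: f_def less_imp_le)
        finally show ?thesis by simp
      qed
    qed
    moreover have "f z - f w = (\<phi> ^^ n) z - (\<phi> ^^ n) w"
      using zw iter_self_map by (simp add: f_def T_iter_apply monomial_def)
    ultimately show ?thesis by (simp add: algebra_simps add_increasing)
  qed
  moreover have "\<bar>M 1 * C\<bar> * G + 1 > 0" using G(1) by (simp add: add_nonneg_pos)
  ultimately show ?thesis by blast
qed

text \<open>The basin \<open>U\<close> of \<open>x0\<close> contains every point of X within a fixed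
  distance of it, because the iterates share one Lipschitz constant. Hence \<open>U\<close> and its
  complement are open in X, and connectedness gives \<open>U = X\<close>.\<close>

lemma attracted:
  assumes "d > 0" "z \<in> X"
  shows "\<exists>n. cmod ((\<phi> ^^ n) z - x0) < d"
proof -
  obtain r d0 where r: "0 \<le> r" "r < 1" "d0 > 0"
    "\<And>w n. w \<in> X \<Longrightarrow> cmod (w - x0) < d0 \<Longrightarrow> cmod ((\<phi> ^^ n) w - x0) \<le> r ^ n * cmod (w - x0)"
    using attracting by blast
  obtain K where K: "K > 0" "\<And>n z w. z \<in> X \<Longrightarrow> w \<in> X \<Longrightarrow> cmod ((\<phi> ^^ n) z - (\<phi> ^^ n) w) \<le> K * cmod (z - w)"
    using iterates_equi_lipschitz by blast
  define U where "U = {z \<in> X. \<exists>n. cmod ((\<phi> ^^ n) z - x0) < d0}"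
  have enter: "\<exists>n. cmod ((\<phi> ^^ n) w - x0) < e" if w: "w \<in> U" and e: "e > 0" for w e
  proof -
    obtain m where m: "w \<in> X" "cmod ((\<phi> ^^ m) w - x0) < d0" using w by (auto simp: U_def)
    have "(\<lambda>n. r ^ n * d0) \<longlonglongrightarrow> 0 * d0" using r by (intro tendsto_intros LIMSEQ_power_zero) auto
    then obtain n where n: "r ^ n * d0 < e" using tendsto_0D[of "\<lambda>n. r ^ n * d0" e] e by auto
    have "cmod ((\<phi> ^^ n) ((\<phi> ^^ m) w) - x0) \<le> r ^ n * cmod ((\<phi> ^^ m) w - x0)"
      by (rule r(4)[OF iter_self_map[OF m(1)] m(2)])
    also have "\<dots> \<le> r ^ n * d0" using m r by (intro mult_left_mono) auto
    finally show ?thesis using n by (intro exI[of _ "n + m"]) (simp add: funpow_add)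
  qed
  \<comment> \<open>Iterates of points closer than \<open>\<eta>\<close> stay within
    \<open>d0 / 2\<close>, the other half being left for the orbit already attracted. The same
    \<open>\<eta>\<close> serves all points, which is what makes the complement open.\<close>
  define \<eta> where "\<eta> = d0 / (2 * K)"
  have eta: "\<eta> > 0" using r K by (simp add: \<eta>_def)
  have spread: "z \<in> U" if w: "w \<in> U" and z: "z \<in> X" "cmod (z - w) < \<eta>" for z w
  proof -
    obtain n where n: "cmod ((\<phi> ^^ n) w - x0) < d0 / 2" using enter[OF w, of "d0 / 2"] r by auto
    have "cmod ((\<phi> ^^ n) z - x0) \<le> cmod ((\<phi> ^^ n) z - (\<phi> ^^ n) w) + cmod ((\<phi> ^^ n) w - x0)"
      using norm_triangle_ineq[of "(\<phi> ^^ n) z - (\<phi> ^^ n) w" "(\<phi> ^^ n) w - x0"] by simp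
    also have "cmod ((\<phi> ^^ n) z - (\<phi> ^^ n) w) \<le> K * cmod (z - w)" using K z w by (simp add: U_def)
    also have "\<dots> \<le> K * \<eta>" using K z by simp
    also have "K * \<eta> = d0 / 2" using K by (simp add: \<eta>_def)
    finally have "cmod ((\<phi> ^^ n) z - x0) < d0" using n by simp
    then show ?thesis using z by (auto simp: U_def)
  qed
  have "U \<subseteq> X" by (auto simp: U_def)
  then have "openin (top_of_set X) U"
    unfolding openin_euclidean_subtopology_iff dist_norm using eta spread by blast
  moreover have "openin (top_of_set X) (X - U)"
    unfolding openin_euclidean_subtopology_iff dist_norm
    using eta spread by (metis Diff_iff Diff_subset norm_minus_commute)
  then have "closedin (top_of_set X) U" by (auto simp: closedin_def U_def)
  moreover have "x0 \<in> U" using x0 r by (auto simp: U_def intro!: exI[of _ 0])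
  ultimately have "U = X"
    using uniformly_regular_connected[OF reg] unfolding connected_clopen by blast
  then show ?thesis using enter[of z d] assms by simp
qed

text \<open>Choose \<open>k\<close> with \<open>r ^ k < cmod \<mu>\<close>. Near \<open>x0\<close>,
  the values of \<open>f\<close> along an orbit decay like \<open>(r ^ k) ^ n\<close> by flatness
  but equal \<open>\<mu> ^ n * f w\<close>, so \<open>f w = 0\<close>. Every orbit enters this disc,
  and the eigenvalue equation carries the zero back to its start.\<close>

lemma flat_eigenfunction_zero:
  assumes f: "\<And>k. f \<in> vanishing k" and eig: "T f - (\<lambda>z. \<mu> * f z) = 0" and "\<mu> \<noteq> 0"
  shows "f = 0"
proof
  fix z
  show "f z = 0 z"
  proof (cases "z \<in> X")
    case False
    then show ?thesis using Dspace_chain(3)[OF vanishing_Dspace[OF f]] by simp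
  next
    case z: True
    obtain r d where r: "0 \<le> r" "r < 1" "d > 0"
      "\<And>w n. w \<in> X \<Longrightarrow> cmod (w - x0) < d \<Longrightarrow> cmod ((\<phi> ^^ n) w - x0) \<le> r ^ n * cmod (w - x0)"
      using attracting by blast
    have step: "f (\<phi> u) = \<mu> * f u" if "u \<in> X" for u
      using fun_cong[OF eig, of u] that by (simp add: T_apply)
    have iter: "f ((\<phi> ^^ n) u) = \<mu> ^ n * f u" if "u \<in> X" for u n
      by (induction n) (use step iter_self_map that in auto)
    obtain m where m: "cmod ((\<phi> ^^ m) z - x0) < d" using attracted[OF r(3) z] by blast
    define w where "w = (\<phi> ^^ m) z"
    have w: "w \<in> X" using iter_self_map z by (simp add: w_def)
    obtain k where k: "r ^ k < cmod \<mu>"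
      using tendsto_0D[OF LIMSEQ_power_zero, of r "cmod \<mu>"] r assms(3) by auto
    define q where "q = r ^ k / cmod \<mu>"
    have q: "0 \<le> q" "q < 1" using k r assms(3) by (auto simp: q_def)
    obtain C where C: "C \<ge> 0" "\<And>z. z \<in> X \<Longrightarrow> cmod (f z) \<le> C * cmod (z - x0) ^ k" using vanishingE[OF f] by metis
    have "cmod (f w) \<le> (C * cmod (w - x0) ^ k) * q ^ n" for n
    proof -
      have "cmod \<mu> ^ n * cmod (f w) = cmod (f ((\<phi> ^^ n) w))" using iter[OF w] by (simp add: norm_mult norm_power)
      also have "\<dots> \<le> C * cmod ((\<phi> ^^ n) w - x0) ^ k" by (rule C(2)[OF iter_self_map[OF w]])
      also have "\<dots> \<le> C * (r ^ n * cmod (w - x0)) ^ k"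
        using r(4)[OF w, of n] m C(1) by (intro mult_left_mono power_mono) (auto simp: w_def)
      also have "\<dots> = (C * cmod (w - x0) ^ k) * (r ^ k) ^ n"
        by (simp add: power_mult_distrib mult_ac flip: power_mult)
      finally show ?thesis using assms(3) by (simp add: q_def power_divide field_simps)
    qed
    moreover have "(\<lambda>n. (C * cmod (w - x0) ^ k) * q ^ n) \<longlonglongrightarrow> (C * cmod (w - x0) ^ k) * 0"
      using q by (intro tendsto_intros LIMSEQ_power_zero) auto
    ultimately have "cmod (f w) \<le> (C * cmod (w - x0) ^ k) * 0" by (intro LIMSEQ_le_const) auto
    then have "f w = 0" by simp
    then show ?thesis using iter[OF z, of m] assms(3) by (simp add: w_def)
  qed
qed

section \<open>Location and multiplicity of the spectral points\<close>

text \<open>On functions of order \<open>n\<close> modulo order \<open>n + 1\<close>,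
  \<open>T - \<mu>\<close> acts as the nonzero scalar \<open>lam ^ n - \<mu>\<close>, so the order
  of \<open>f\<close> can be raised one step at a time.\<close>

lemma shift_vanishing:
  assumes "f \<in> vanishing m" "T f - (\<lambda>z. \<mu> * f z) \<in> vanishing n" "m \<le> n"
    and "\<And>j. m \<le> j \<Longrightarrow> j < n \<Longrightarrow> \<mu> \<noteq> lam ^ j"
  shows "f \<in> vanishing n"
  using assms(3,2,4)
proof (induction n rule: dec_induct)
  case base
  show ?case by (rule assms(1))
next
  case (step n)
  have f: "f \<in> vanishing n"
    using step vanishing_antimono[of n "Suc n"] by auto
  have "(T f - (\<lambda>z. \<mu> * f z)) - (T f - (\<lambda>z. lam ^ n * f z)) \<in> vanishing (Suc n)"
    by (rule vanishing_diff[OF step.prems(1) T_diagonal[OF f]])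
  also have "(T f - (\<lambda>z. \<mu> * f z)) - (T f - (\<lambda>z. lam ^ n * f z)) = (\<lambda>z. (lam ^ n - \<mu>) * f z)"
    by (rule ext) (simp add: algebra_simps)
  finally have "(\<lambda>z. inverse (lam ^ n - \<mu>) * ((lam ^ n - \<mu>) * f z)) \<in> vanishing (Suc n)"
    by (rule vanishing_scale)
  moreover have "lam ^ n - \<mu> \<noteq> 0" using step by auto
  ultimately show ?case by (simp flip: mult.assoc)
qed

lemma vanishing_0_eq: "vanishing 0 = Dspace X M"
  using vanishing_iff by auto

text \<open>When \<open>\<mu>\<close> avoids all later powers, the order of \<open>f\<close> rises
  without end; an eigenfunction that is flat at \<open>x0\<close> is 0.\<close>

lemma shift_injective:
  assumes "f \<in> vanishing m" "T f - (\<lambda>z. \<mu> * f z) = 0" "\<mu> \<noteq> 0" "\<And>j. m \<le> j \<Longrightarrow> \<mu> \<noteq> lam ^ j"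
  shows "f = 0"
proof (rule flat_eigenfunction_zero[OF _ assms(2,3)])
  fix k
  have "f \<in> vanishing (max m k)"
    by (rule shift_vanishing[OF assms(1), of \<mu>]) (use assms vanishing_0 in auto)
  then show "f \<in> vanishing k" using vanishing_antimono[of k "max m k"] by auto
qed

text \<open>A solution of \<open>(T - lam ^ n) f = monomial m\<close> would have order
  \<open>m\<close>, hence \<open>(T - lam ^ m) f\<close> would have order \<open>m + 1\<close>,
  which \<open>monomial m\<close> has not.\<close>

lemma power_in_spectrum: "lam ^ n \<in> spectrum_op X M T"
proof -
  \<comment> \<open>Powers of \<open>lam\<close> coincide when \<open>lam = 0\<close>; taking the
    least exponent keeps the value distinct from all lower powers, as \<open>shift_vanishing\<close>
    requires.\<close>
  define m where "m = (LEAST j. lam ^ j = lam ^ n)"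
  have m: "lam ^ m = lam ^ n" unfolding m_def by (rule LeastI[of _ n]) simp
  have less: "lam ^ n \<noteq> lam ^ j" if "j < m" for j
    using not_less_Least[of j "\<lambda>j. lam ^ j = lam ^ n"] that by (auto simp: m_def)
  have False if S: "bounded_op X M S" "\<forall>f\<in>Dspace X M. shift_op T (lam ^ n) (S f) = f" for S
  proof -
    define f where "f = S (monomial m)"
    have "D.lin_on S" using S(1) by (simp add: bounded_op_iff D.bounded_on_def)
    then have f: "f \<in> Dspace X M" unfolding f_def using D.lin_on_V monomial_Dspace by blast
    have eq: "T f - (\<lambda>z. lam ^ n * f z) = monomial m"
      using S(2) monomial_Dspace by (simp add: f_def shift_op_eq)
    have "f \<in> vanishing m"
      by (rule shift_vanishing[of f 0 "lam ^ n"]) (use f vanishing_0_eq eq monomial_vanishing less in auto)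
    from T_diagonal[OF this] have "monomial m \<in> vanishing (Suc m)" using eq m by simp
    then show False using scaled_monomial_not_vanishing[of 1 m] by simp
  qed
  then show ?thesis unfolding spectrum_op_def invertible_op_def by blast
qed

text \<open>A bounded left inverse bounds \<open>T\<close> below by some \<open>c\<close>, hence
  \<open>T ^^ n\<close> by \<open>c ^ n\<close>. A Riesz sequence along the infinite filtration then
  keeps separated images, against \<open>no_separated_images\<close>.\<close>

lemma zero_in_spectrum: "0 \<in> spectrum_op X M T"
proof -
  have False if S: "bounded_op X M S" "\<forall>f\<in>Dspace X M. S (shift_op T 0 f) = f" for S
  proof -
    have Sb: "D.bounded_on S" using S by (simp add: bounded_op_iff)
    obtain C where C: "C > 0" "\<And>x. x \<in> Dspace X M \<Longrightarrow> normD X M (S x) \<le> C * normD X M x"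
      using D.bounded_onE[OF Sb] by blast
    define c where "c = 1 / C"
    have c: "c > 0" using C by (simp add: c_def)
    have ST: "S (T f) = f" if "f \<in> Dspace X M" for f
      using S(2) that by (simp add: shift_op_def)
    have below: "normD X M (T f) \<ge> c * normD X M f" if f: "f \<in> Dspace X M" for f
      using C(2)[OF T_Dspace[OF f]] ST[OF f] C(1) by (simp add: c_def field_simps)
    have Tn: "(T ^^ n) f \<in> Dspace X M" if "f \<in> Dspace X M" for f n
      using D.lin_on_V[OF D.lin_on_pow[OF T_lin] that] .
    have below_n: "normD X M ((T ^^ n) f) \<ge> c ^ n * normD X M f" if f: "f \<in> Dspace X M" for f n
    proof (induction n)
      case (Suc n)
      have "c * (c ^ n * normD X M f) \<le> c * normD X M ((T ^^ n) f)" using Suc c by simp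
      also have "\<dots> \<le> normD X M ((T ^^ Suc n) f)" using below[OF Tn[OF f]] by simp
      finally show ?case by simp
    qed simp
    obtain y where y: "\<And>k. y k \<in> vanishing k" "\<And>k. normD X M (y k) = 1"
      "\<And>k w. w \<in> vanishing (Suc k) \<Longrightarrow> normD X M (y k - w) \<ge> 1/2"
      using D.riesz_sequence[of vanishing, OF vanishing_closed vanishing_strict] by metis
    have yD: "y k \<in> Dspace X M" for k using y(1) vanishing_Dspace by blast
    have "normD X M ((T ^^ n) (y k) - (T ^^ n) (y l)) \<ge> c ^ n / 2" if kl: "k < l" for n k l
    proof -
      have "y l \<in> vanishing (Suc k)" using y(1)[of l] vanishing_antimono[of "Suc k" l] kl by auto
      then have "c ^ n * (1/2) \<le> c ^ n * normD X M (y k - y l)" using y(3) c by (intro mult_left_mono) auto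
      also have "\<dots> \<le> normD X M ((T ^^ n) (y k - y l))" by (rule below_n[OF Dspace_diff(1)[OF yD yD]])
      also have "(T ^^ n) (y k - y l) = (T ^^ n) (y k) - (T ^^ n) (y l)"
        by (rule D.lin_on_diff[OF D.lin_on_pow[OF T_lin] yD yD])
      finally show ?thesis by (simp add: fun_diff_def)
    qed
    then show False
      using D.no_separated_images[OF T_lin riesz_near_compact[OF riesz c] c, of y] yD y(2) by auto
  qed
  then show ?thesis unfolding spectrum_op_def invertible_op_def by blast
qed

lemma spectrum_eq: "spectrum_op X M T = {lam ^ n | n. n \<ge> 1} \<union> {0, 1}"
proof (intro equalityI subsetI)
  fix \<mu> assume mu: "\<mu> \<in> spectrum_op X M T"
  show "\<mu> \<in> {lam ^ n | n. n \<ge> 1} \<union> {0, 1}"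
  proof (rule ccontr)
    assume neg: "\<not> ?thesis"
    \<comment> \<open>The exponent 0 is covered by the listed point 1.\<close>
    have "\<mu> \<noteq> lam ^ j" for j
    proof (cases "j = 0")
      case False
      then have "j \<ge> 1" by simp
      then show ?thesis using neg by blast
    qed (use neg in simp)
    moreover have "\<mu> \<noteq> 0" using neg by simp
    ultimately have "\<mu> \<notin> spectrum_op X M T"
      using shift_injective[of _ 0 \<mu>] vanishing_0_eq by (intro not_in_spectrum[OF riesz]) auto
    then show False using mu by simp
  qed
next
  fix \<mu> assume "\<mu> \<in> {lam ^ n | n. n \<ge> 1} \<union> {0, 1}"
  then show "\<mu> \<in> spectrum_op X M T"
    using power_in_spectrum power_in_spectrum[of 0] zero_in_spectrum by auto
qed

text \<open>Two equal nonzero powers would make \<open>lam\<close> a root of unity, but its modulus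
  is below 1.\<close>

lemma lam_power_inj:
  assumes "lam ^ j = lam ^ n" "lam ^ n \<noteq> 0"
  shows "j = n"
proof -
  have *: "\<not> i < k" if eq: "lam ^ i = lam ^ k" and nz: "lam ^ k \<noteq> 0" for i k
  proof
    assume "i < k"
    then have "lam ^ k = lam ^ i * lam ^ (k - i)" by (simp flip: power_add)
    then have "lam ^ i * lam ^ (k - i) = lam ^ i * 1" using eq by simp
    then have "lam ^ (k - i) = 1" using eq nz mult_left_cancel by metis
    then have "cmod lam ^ (k - i) = 1" by (metis norm_one norm_power)
    moreover have "cmod lam ^ (k - i) < 1" 
    proof -
      have "1 \<le> k - i" using \<open>i < k\<close> by simp
      then have "cmod lam ^ (k - i) \<le> cmod lam ^ 1" using lam_less_1 by (intro power_decreasing) auto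
      then show ?thesis using lam_less_1 by simp
    qed
    ultimately show False by simp
  qed
  show ?thesis using *[of j n] *[of n j] assms by force
qed

text \<open>For the unique \<open>n\<close> with \<open>\<mu> = lam ^ n\<close>, generalised
  eigenfunctions have order \<open>n\<close>, and those of order \<open>n + 1\<close> are 0. So the
  \<open>n\<close>-th Taylor coefficient determines them, and the generalised eigenspace is a
  line.\<close>

lemma spectrum_mult_one:
  assumes "\<mu> \<in> spectrum_op X M T" "\<mu> \<noteq> 0"
  shows "mult_one X M T \<mu>"
proof -
  obtain n where n: "\<mu> = lam ^ n" using assms spectrum_eq by (auto intro: that[of 0])
  define A where "A = shift_op T \<mu>"
  have A: "A f = T f - (\<lambda>z. \<mu> * f z)" for f by (simp add: A_def shift_op_eq)
  have A_lin: "D.lin_on A" unfolding A_def shift_op_eq by (rule D.lin_on_shift[OF T_lin])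
  have A_pow: "D.lin_on (A ^^ k)" for k by (rule D.lin_on_pow[OF A_lin])
  have other: "\<mu> \<noteq> lam ^ j" if "j \<noteq> n" for j using lam_power_inj[of j n] that n assms(2) by auto
  have "\<not> (\<forall>f\<in>Dspace X M. T f - (\<lambda>z. \<mu> * f z) = 0 \<longrightarrow> f = 0)"
    using not_in_spectrum[OF riesz assms(2)] assms(1) by blast
  then obtain g where g: "g \<in> Dspace X M" "A g = 0" "g \<noteq> 0" unfolding A by blast
  have in_n: "f \<in> vanishing n" if "f \<in> Dspace X M" "(A ^^ k) f = 0" for f k
    using that
  proof (induction k arbitrary: f)
    case 0
    then show ?case using vanishing_0 by (metis funpow_0)
  next
    case (Suc k)
    have "A f \<in> vanishing n"
      using Suc.IH[of "A f"] Suc.prems D.lin_on_V[OF A_lin] by (simp add: funpow_swap1)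
    then show ?case
      unfolding A by (intro shift_vanishing[of f 0 \<mu> n]) (use Suc.prems vanishing_0_eq other in auto)
  qed
  have zero: "f = 0" if "f \<in> vanishing (Suc n)" "(A ^^ k) f = 0" for f k
    using that
  proof (induction k arbitrary: f)
    case (Suc k)
    have "A f \<in> vanishing (Suc n)"
      unfolding A by (intro vanishing_diff vanishing_scale T_vanishing Suc.prems)
    moreover have "(A ^^ k) (A f) = 0" using Suc.prems(2) unfolding funpow_Suc_right o_apply .
    ultimately have "A f = 0" by (rule Suc.IH)
    then show ?case
      unfolding A using Suc.prems assms(2) other by (intro shift_injective[of f "Suc n" \<mu>]) auto
  qed simp
  obtain b where b: "g - (\<lambda>z. b * monomial n z) \<in> vanishing (Suc n)"
    using vanishing_leading[OF in_n[of g 1]] g by auto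
  have "b \<noteq> 0"
  proof
    assume "b = 0"
    then have "g - (\<lambda>z. b * monomial n z) = g" by (simp add: fun_eq_iff)
    then have "g \<in> vanishing (Suc n)" using b by metis
    then show False using zero[of g 1] g by auto
  qed
  have "\<exists>c. f = (\<lambda>z. c * g z)" if f: "f \<in> gen_eigenspace X M T \<mu>" for f
  proof -
    obtain k where k: "f \<in> Dspace X M" "(A ^^ k) f = 0"
      using f by (auto simp: gen_eigenspace_def A_def zero_fun_def)
    obtain a where a: "f - (\<lambda>z. a * monomial n z) \<in> vanishing (Suc n)"
      using vanishing_leading[OF in_n[OF k]] by blast
    \<comment> \<open>The factor \<open>a / b\<close> cancels the coefficients of
      \<open>monomial n\<close>, which puts \<open>h\<close> in order \<open>n + 1\<close>.\<close>
    define h where "h = f - (\<lambda>z. a / b * g z)"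
    have "(f - (\<lambda>z. a * monomial n z)) - (\<lambda>z. a / b * (g - (\<lambda>z. b * monomial n z)) z) \<in> vanishing (Suc n)"
      by (rule vanishing_diff[OF a vanishing_scale[OF b]])
    also have "(f - (\<lambda>z. a * monomial n z)) - (\<lambda>z. a / b * (g - (\<lambda>z. b * monomial n z)) z) = h"
      using \<open>b \<noteq> 0\<close> by (simp add: h_def fun_eq_iff field_simps)
    finally have h: "h \<in> vanishing (Suc n)" .
    have gD: "(\<lambda>z. a / b * g z) \<in> Dspace X M" by (rule Dspace_scale(1)[OF g(1)])
    have "A (\<lambda>z. a / b * g z) = (\<lambda>z. a / b * A g z)" by (rule D.lin_on_scale[OF A_lin g(1)])
    then have "A (\<lambda>z. a / b * g z) = 0" using g(2) by (simp add: fun_eq_iff)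
    moreover have "(A ^^ k) 0 = 0" by (rule D.lin_on_0[OF A_pow])
    \<comment> \<open>The exponent \<open>Suc k\<close> kills \<open>g\<close> as well as
      \<open>f\<close>, also when \<open>k = 0\<close>.\<close>
    ultimately have "(A ^^ Suc k) (\<lambda>z. a / b * g z) = 0" by (simp add: funpow_swap1)
    moreover have "(A ^^ Suc k) f = 0" using k(2) D.lin_on_0[OF A_lin] by simp
    ultimately have "(A ^^ Suc k) h = 0"
      unfolding h_def D.lin_on_diff[OF A_pow k(1) gD] by simp
    then have "h = 0" by (rule zero[OF h])
    then have "f = (\<lambda>z. a / b * g z)" unfolding h_def by (rule eq_iff_diff_eq_0[THEN iffD2])
    then show ?thesis by (rule exI)
  qed
  moreover have "g \<in> gen_eigenspace X M T \<mu>"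
    using g by (auto simp: gen_eigenspace_def A_def zero_fun_def intro!: exI[of _ 1])
  ultimately show ?thesis using g(3) unfolding mult_one_def zero_fun_def by blast
qed

end

theorem theorem2p4:
  fixes X :: "complex set" and M :: "nat \<Rightarrow> real" and \<phi> :: "complex \<Rightarrow> complex"
    and T :: "(complex \<Rightarrow> complex) \<Rightarrow> (complex \<Rightarrow> complex)" and x0 :: complex
  assumes "uniformly_regular X"
    and "weight_seq M" and "nonanalytic M"
    and "continuous_on X \<phi>" and "\<phi> ` X \<subseteq> X"
    and "T = comp_op X \<phi>"
    and "\<forall>f\<in>Dspace X M. T f \<in> Dspace X M"
    and "riesz_op X M T"
    and "x0 \<in> X" and "\<phi> x0 = x0"
  shows "spectrum_op X M T = {derivX X \<phi> x0 ^ n | n. n \<ge> 1} \<union> {0, 1}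
    \<and> (\<forall>lam\<in>spectrum_op X M T. lam \<noteq> 0 \<longrightarrow> mult_one X M T lam)"
proof -
  interpret riesz_composition X M x0 \<phi> T
    by unfold_locales (use assms in auto)
  show ?thesis using spectrum_eq spectrum_mult_one by (simp add: lam_def)
qed

end
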